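(* Let $G$ be a group which is a semidirect (i.e. split) extension $$0\to K\to G\to H\to 0,$$ so that $G\cong K\rtimes H$, where $H$ is a post-injunctive group and $K$ is a finitely generated residually finite group. Then $G$ is post-injunctive.
   Context: For a group $G$ and a set $A$ (the alphabet), $A^G$ is the set of all maps $x\colon G\to A$ (configurations), with shift action $(gx)(h)=x(g^{-1}h)$. A cellular automaton $\tau\colon A^G\to A^G$ is a map for which there exist a finite subset $M\subset G$ (a memory set) and a map $\mu\colon A^M\to A$ (the local transition map) such that $\tau(x)(g)=\mu((g^{-1}x)|_M)$ for all $x\in A^G$, $g\in G$. Two configurations $x,y\in A^G$ are asymptotic if $x|_{G\setminus E}=y|_{G\setminus E}$ for some finite $E\subset G$. The cellular automaton $\tau$ is pre-injective if for all asymptotic $x,y\in A^G$, $\tau(x)=\tau(y)$ implies $x=y$. It is post-surjective if for all $x,y\in A^G$ with $y$ asymptotic to $\tau(x)$, there exists $z\in A^G$ asymptotic to $x$ with $\tau(z)=y$. A group $G$ is post-injunctive if for every finite alphabet $A$, every post-surjective cellular automaton $\tau\colon A^G\to A^G$ is pre-injective. *)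

theory Defs
  imports "HOL-Algebra.Algebra" "HOL-Library.FuncSet"
begin

text \<open>The configuration space is the set of extensional functions on the carrier of the group.\<close>

definition configs :: "('g, 'm) monoid_scheme \<Rightarrow> 'a set \<Rightarrow> ('g \<Rightarrow> 'a) set" where
  "configs G A = (carrier G \<rightarrow>\<^sub>E A)"

definition shift :: "('g, 'm) monoid_scheme \<Rightarrow> 'g \<Rightarrow> ('g \<Rightarrow> 'a) \<Rightarrow> 'g \<Rightarrow> 'a" where
  "shift G g x = (\<lambda>h\<in>carrier G. x (inv\<^bsub>G\<^esub> g \<otimes>\<^bsub>G\<^esub> h))"

definition cellular_automaton ::
    "('g, 'm) monoid_scheme \<Rightarrow> 'a set \<Rightarrow> (('g \<Rightarrow> 'a) \<Rightarrow> 'g \<Rightarrow> 'a) \<Rightarrow> bool" where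
  "cellular_automaton G A \<tau> \<longleftrightarrow>
     \<tau> \<in> configs G A \<rightarrow> configs G A \<and>
     (\<exists>M \<mu>. finite M \<and> M \<subseteq> carrier G \<and> \<mu> \<in> (M \<rightarrow>\<^sub>E A) \<rightarrow> A \<and>
        (\<forall>x\<in>configs G A. \<forall>g\<in>carrier G.
           \<tau> x g = \<mu> (restrict (shift G (inv\<^bsub>G\<^esub> g) x) M)))"

definition asymptotic :: "('g, 'm) monoid_scheme \<Rightarrow> ('g \<Rightarrow> 'a) \<Rightarrow> ('g \<Rightarrow> 'a) \<Rightarrow> bool" where
  "asymptotic G x y \<longleftrightarrow>
     (\<exists>E. finite E \<and> E \<subseteq> carrier G \<and> restrict x (carrier G - E) = restrict y (carrier G - E))"

definition pre_injective ::
    "('g, 'm) monoid_scheme \<Rightarrow> 'a set \<Rightarrow> (('g \<Rightarrow> 'a) \<Rightarrow> 'g \<Rightarrow> 'a) \<Rightarrow> bool" where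
  "pre_injective G A \<tau> \<longleftrightarrow>
     (\<forall>x\<in>configs G A. \<forall>y\<in>configs G A. asymptotic G x y \<longrightarrow> \<tau> x = \<tau> y \<longrightarrow> x = y)"

definition post_surjective ::
    "('g, 'm) monoid_scheme \<Rightarrow> 'a set \<Rightarrow> (('g \<Rightarrow> 'a) \<Rightarrow> 'g \<Rightarrow> 'a) \<Rightarrow> bool" where
  "post_surjective G A \<tau> \<longleftrightarrow>
     (\<forall>x\<in>configs G A. \<forall>y\<in>configs G A. asymptotic G y (\<tau> x) \<longrightarrow>
        (\<exists>z\<in>configs G A. asymptotic G z x \<and> \<tau> z = y))"

text \<open>HOL cannot quantify over types inside a formula, so the alphabets range over the finite
  sets of natural numbers. Up to relabelling these are all finite alphabets; see
  \<open>post_injunctive_alphabet\<close> below for alphabets of an arbitrary type.\<close>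

definition post_injunctive :: "('g, 'm) monoid_scheme \<Rightarrow> bool" where
  "post_injunctive G \<longleftrightarrow>
     (\<forall>A :: nat set. finite A \<longrightarrow>
        (\<forall>\<tau>. cellular_automaton G A \<tau> \<longrightarrow> post_surjective G A \<tau> \<longrightarrow> pre_injective G A \<tau>))"

definition finitely_generated :: "('g, 'm) monoid_scheme \<Rightarrow> bool" where
  "finitely_generated G \<longleftrightarrow> (\<exists>S. finite S \<and> S \<subseteq> carrier G \<and> generate G S = carrier G)"

definition residually_finite :: "('g, 'm) monoid_scheme \<Rightarrow> bool" where
  "residually_finite G \<longleftrightarrow>
     (\<forall>g\<in>carrier G. g \<noteq> \<one>\<^bsub>G\<^esub> \<longrightarrow> (\<exists>N. N \<lhd> G \<and> finite (rcosets\<^bsub>G\<^esub> N) \<and> g \<notin> N))"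

text \<open>The sequence \<open>K \<rightarrow> G \<rightarrow> H\<close> of \<open>i\<close> and \<open>p\<close> is short exact and \<open>s\<close> splits it. The library's
  \<open>exact_seq\<close> forces all groups to have the same element type.\<close>

definition split_extension ::
    "('k, 'm1) monoid_scheme \<Rightarrow> ('g, 'm2) monoid_scheme \<Rightarrow> ('h, 'm3) monoid_scheme \<Rightarrow>
     ('k \<Rightarrow> 'g) \<Rightarrow> ('g \<Rightarrow> 'h) \<Rightarrow> ('h \<Rightarrow> 'g) \<Rightarrow> bool" where
  "split_extension K G H i p s \<longleftrightarrow>
     i \<in> mon K G \<and> p \<in> epi G H \<and> i ` carrier K = kernel G H p \<and>
     s \<in> hom H G \<and> (\<forall>h\<in>carrier H. p (s h) = h)"

lemma post_injunctive_alphabet: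
  fixes G :: "('g, 'm) monoid_scheme" and B :: "'b set"
  assumes "group G" "post_injunctive G" "finite B"
    and ca: "cellular_automaton G B \<tau>" and ps: "post_surjective G B \<tau>"
  shows "pre_injective G B \<tau>"
proof -
  interpret group G by fact
  define A :: "nat set" where "A = {0..<card B}"
  obtain f where f: "bij_betw f B A"
    using ex_bij_betw_finite_nat[OF \<open>finite B\<close>] A_def by blast
  define f' where "f' = the_inv_into B f"
  have f': "bij_betw f' A B" unfolding f'_def by (rule bij_betw_the_inv_into[OF f])
  have fA: "f b \<in> A" and f'f: "f' (f b) = b" if "b \<in> B" for b
    using f that by (auto simp: bij_betw_def f'_def the_inv_into_f_f)
  have f'B: "f' a \<in> B" and ff': "f (f' a) = a" if "a \<in> A" for a
    using f f' that by (auto simp: bij_betw_def f'_def f_the_inv_into_f)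
  define F where "F = (\<lambda>x. \<lambda>h\<in>carrier G. f (x h))"
  define F' where "F' = (\<lambda>x. \<lambda>h\<in>carrier G. f' (x h))"
  have FA: "F x \<in> configs G A" and F'F: "F' (F x) = x" if "x \<in> configs G B" for x
    using that by (auto simp: F_def F'_def configs_def fA f'f PiE_iff extensional_def fun_eq_iff)
  have F'B: "F' x \<in> configs G B" and FF': "F (F' x) = x" if "x \<in> configs G A" for x
    using that by (auto simp: F_def F'_def configs_def f'B ff' PiE_iff extensional_def fun_eq_iff)
  have as_iff: "asymptotic G x y \<longleftrightarrow>
      (\<exists>E. finite E \<and> E \<subseteq> carrier G \<and> (\<forall>g\<in>carrier G - E. x g = y g))"
    for x y :: "'g \<Rightarrow> 'c"
    unfolding asymptotic_def fun_eq_iff restrict_def by metis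
  have asF: "asymptotic G (F x) (F y)" if "asymptotic G x y" for x y
    using that unfolding as_iff F_def by force
  have asF': "asymptotic G (F' x) (F' y)" if "asymptotic G x y" for x y
    using that unfolding as_iff F'_def by force
  define \<sigma> where "\<sigma> = F \<circ> \<tau> \<circ> F'"
  have \<tau>B: "\<tau> x \<in> configs G B" if "x \<in> configs G B" for x
    using ca that by (auto simp: cellular_automaton_def)
  obtain M \<mu> where M: "finite M" "M \<subseteq> carrier G" "\<mu> \<in> (M \<rightarrow>\<^sub>E B) \<rightarrow> B"
    and \<mu>: "\<And>x g. x \<in> configs G B \<Longrightarrow> g \<in> carrier G \<Longrightarrow>
      \<tau> x g = \<mu> (restrict (shift G (inv\<^bsub>G\<^esub> g) x) M)"
    using ca unfolding cellular_automaton_def by blast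
  define \<nu> where "\<nu> = (\<lambda>w. f (\<mu> (\<lambda>m\<in>M. f' (w m))))"
  have "\<nu> \<in> (M \<rightarrow>\<^sub>E A) \<rightarrow> A"
  proof
    fix w assume "w \<in> M \<rightarrow>\<^sub>E A"
    then have "(\<lambda>m\<in>M. f' (w m)) \<in> M \<rightarrow>\<^sub>E B" by (auto intro!: f'B)
    then show "\<nu> w \<in> A" unfolding \<nu>_def using M(3) by (blast intro: fA)
  qed
  moreover have "\<sigma> x g = \<nu> (restrict (shift G (inv\<^bsub>G\<^esub> g) x) M)"
    if x: "x \<in> configs G A" and g: "g \<in> carrier G" for x g
  proof -
    have "restrict (shift G (inv\<^bsub>G\<^esub> g) (F' x)) M =
        (\<lambda>m\<in>M. f' (restrict (shift G (inv\<^bsub>G\<^esub> g) x) M m))"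
      using M(2) g by (auto simp: fun_eq_iff shift_def F'_def)
    then show ?thesis
      using \<mu>[OF F'B[OF x] g] g by (simp add: \<sigma>_def \<nu>_def F_def)
  qed
  moreover have "\<sigma> \<in> configs G A \<rightarrow> configs G A"
    by (auto simp: \<sigma>_def FA \<tau>B F'B)
  ultimately have "cellular_automaton G A \<sigma>"
    unfolding cellular_automaton_def using M(1,2) by blast
  moreover have "post_surjective G A \<sigma>"
    unfolding post_surjective_def
  proof (intro ballI impI)
    fix x y assume x: "x \<in> configs G A" and y: "y \<in> configs G A"
      and as: "asymptotic G y (\<sigma> x)"
    have "asymptotic G (F' y) (\<tau> (F' x))"
      using asF'[OF as] by (simp add: \<sigma>_def F'F \<tau>B F'B x)
    then obtain z where z: "z \<in> configs G B" "asymptotic G z (F' x)" "\<tau> z = F' y"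
      using ps F'B[OF x] F'B[OF y] unfolding post_surjective_def by blast
    have "asymptotic G (F z) x" using asF[OF z(2)] by (simp add: FF' x)
    moreover have "\<sigma> (F z) = y" by (simp add: \<sigma>_def F'F z FF' y)
    ultimately show "\<exists>z\<in>configs G A. asymptotic G z x \<and> \<sigma> z = y" using FA[OF z(1)] by blast
  qed
  ultimately have inj: "pre_injective G A \<sigma>"
    using \<open>post_injunctive G\<close> unfolding post_injunctive_def A_def by blast
  show ?thesis
    unfolding pre_injective_def
  proof (intro ballI impI)
    fix x y assume x: "x \<in> configs G B" and y: "y \<in> configs G B"
      and as: "asymptotic G x y" and eq: "\<tau> x = \<tau> y"
    have "\<sigma> (F x) = \<sigma> (F y)" by (simp add: \<sigma>_def F'F x y eq)
    then have "F x = F y"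
      using inj FA[OF x] FA[OF y] asF[OF as] unfolding pre_injective_def by blast
    then show "x = y" using F'F x y by metis
  qed
qed

end

theory Submission
  imports Defs "HOL-Analysis.Function_Topology"
begin

text \<open>By compactness, a post-surjective automaton \<open>\<tau>\<close> on \<open>G\<close> can correct a change of \<open>\<tau> x\<close> at one site
  by a change of \<open>x\<close> inside a translate of a fixed finite set \<open>E\<close>. Hence, if \<open>L\<close> is a normal subgroup
  of \<open>G\<close> missing a finite set that depends on \<open>E\<close> and the memory set, corrections along an \<open>L\<close>-orbit do
  not interact, and \<open>\<tau>\<close> is post-surjective on the \<open>L\<close>-periodic configurations. Likewise, two distinct
  asymptotic configurations with the same image can be repeated along such an \<open>L\<close> to give two periodic
  ones. Since \<open>K\<close> is finitely generated and residually finite, \<open>L\<close> can be chosen of finite index in \<open>K\<close>;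
  then the \<open>L\<close>-periodic configurations on \<open>G\<close> are the configurations on \<open>H\<close> over a finite alphabet, and
  post-injunctivity of \<open>H\<close> applies.\<close>

subsection \<open>Finite-index subgroups of residually finite groups\<close>

lemma (in group) hom_eq_on_generate:
  assumes "group Q" "f \<in> hom G Q" "g \<in> hom G Q" "S \<subseteq> carrier G"
    and "\<And>x. x \<in> S \<Longrightarrow> f x = g x" and x: "x \<in> generate G S"
  shows "f x = g x"
proof -
  interpret f: group_hom G Q f using assms by (simp add: group_hom_def group_hom_axioms_def group_axioms)
  interpret g: group_hom G Q g using assms by (simp add: group_hom_def group_hom_axioms_def group_axioms)
  show ?thesis using x
  proof (induction rule: generate.induct)
    case (inv h)
    then show ?case using assms(4,5) by (metis f.hom_inv g.hom_inv subsetD)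
  next
    case (eng h1 h2)
    then show ?case using generate_in_carrier[OF assms(4)] by simp
  qed (use assms in auto)
qed

text \<open>A homomorphism is determined by its values on a finite generating set, and only finitely
  many value tables exist. The restriction to the carrier is there because \<open>hom\<close> leaves
  values outside the carrier arbitrary.\<close>

lemma (in group) finite_homs:
  assumes "finitely_generated G" "group Q" "finite (carrier Q)"
  shows "finite ((\<lambda>f. restrict f (carrier G)) ` hom G Q)"
proof -
  obtain S where S: "finite S" "S \<subseteq> carrier G" "generate G S = carrier G"
    using assms(1) unfolding finitely_generated_def by blast
  have "(\<lambda>f. restrict f S) ` hom G Q \<subseteq> (S \<rightarrow>\<^sub>E carrier Q)"
    using S(2) by (auto simp: hom_def)
  then have "finite ((\<lambda>f. restrict f S) ` hom G Q)"
    using S(1) assms(3) by (meson finite_PiE finite_subset)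
  \<comment> \<open>The homomorphism chosen by \<open>inv_into\<close> need not be \<open>f\<close>,
    but it agrees with \<open>f\<close> on the generators, hence on the carrier.\<close>
  moreover have "restrict f (carrier G) = (\<lambda>x\<in>carrier G. inv_into (hom G Q) (\<lambda>f. restrict f S) (restrict f S) x)"
    if f: "f \<in> hom G Q" for f
  proof (rule restrict_ext)
    fix x assume x: "x \<in> carrier G"
    let ?F = "\<lambda>f. restrict f S" let ?f = "inv_into (hom G Q) ?F (?F f)"
    have "?f \<in> hom G Q" "?F ?f = ?F f"
      using inv_into_into[of "?F f" ?F] f_inv_into_f[of "?F f" ?F] f by blast+
    then have "\<And>y. y \<in> S \<Longrightarrow> f y = ?f y" by (metis restrict_apply')
    then show "f x = ?f x"
      using hom_eq_on_generate[OF assms(2) f \<open>?f \<in> hom G Q\<close> S(2)] x S(3) by blast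
  qed
  then have "(\<lambda>f. restrict f (carrier G)) ` hom G Q \<subseteq>
      (\<lambda>r. \<lambda>x\<in>carrier G. inv_into (hom G Q) (\<lambda>f. restrict f S) r x) ` (\<lambda>f. restrict f S) ` hom G Q"
    by blast
  ultimately show ?thesis by (meson finite_imageI finite_subset)
qed

text \<open>The subgroup is the common kernel of all homomorphisms to finitely many finite quotients.\<close>

lemma (in group) residually_finite_fully_invariant:
  assumes fg: "finitely_generated G" and rf: "residually_finite G"
    and P: "finite P" "P \<subseteq> carrier G" "\<one> \<notin> P"
  obtains C T where "subgroup C G" "C \<inter> P = {}" "finite T" "T \<subseteq> carrier G"
    "\<And>x. x \<in> carrier G \<Longrightarrow> \<exists>t\<in>T. x \<otimes> inv t \<in> C"
    "\<And>\<alpha> c. \<alpha> \<in> hom G G \<Longrightarrow> c \<in> C \<Longrightarrow> \<alpha> c \<in> C"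
proof -
  have "\<forall>q\<in>P. \<exists>N. N \<lhd> G \<and> finite (rcosets N) \<and> q \<notin> N"
    using rf P unfolding residually_finite_def by (metis subsetD)
  then obtain N where N: "\<And>q. q \<in> P \<Longrightarrow> N q \<lhd> G"
      "\<And>q. q \<in> P \<Longrightarrow> finite (rcosets (N q))" "\<And>q. q \<in> P \<Longrightarrow> q \<notin> N q"
    by metis
  define Q where "Q q = G Mod N q" for q
  have Q: "group (Q q)" "finite (carrier (Q q))" if "q \<in> P" for q
    using N[OF that] normal.factorgroup_is_group by (auto simp: Q_def FactGroup_def)
  have gh: "group_hom G (Q q) f" if "q \<in> P" "f \<in> hom G (Q q)" for q f
    using that Q by (simp add: group_hom_def group_hom_axioms_def group_axioms)
  define C where "C = {x \<in> carrier G. \<forall>q\<in>P. \<forall>f\<in>hom G (Q q). f x = \<one>\<^bsub>Q q\<^esub>}"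
  have Cf: "f x = \<one>\<^bsub>Q q\<^esub>" if "x \<in> C" "q \<in> P" "f \<in> hom G (Q q)" for x q f
    using that by (simp add: C_def)
  have CG: "C \<subseteq> carrier G" by (auto simp: C_def)
  have sub: "subgroup C G"
  proof
    fix x y assume xy: "x \<in> C" "y \<in> C"
    have "f (x \<otimes> y) = \<one>\<^bsub>Q q\<^esub>" if "q \<in> P" "f \<in> hom G (Q q)" for q f
    proof -
      interpret group_hom G "Q q" f using gh that by blast
      show ?thesis using Cf[OF xy(1) that] Cf[OF xy(2) that] xy CG by (simp add: subset_iff)
    qed
    then show "x \<otimes> y \<in> C" using xy by (auto simp: C_def)
  next
    show "\<one> \<in> C"
      using gh group_hom.hom_one by (fastforce simp: C_def)
  next
    fix x assume x: "x \<in> C"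
    have "f (inv x) = \<one>\<^bsub>Q q\<^esub>" if "q \<in> P" "f \<in> hom G (Q q)" for q f
    proof -
      interpret group_hom G "Q q" f using gh that by blast
      show ?thesis using Cf[OF x that] x CG by (simp add: subset_iff)
    qed
    then show "inv x \<in> C" using x by (auto simp: C_def)
  qed (auto simp: C_def)
  have disj: "C \<inter> P = {}"
  proof -
    have "q \<notin> C" if q: "q \<in> P" for q
    proof
      assume "q \<in> C"
      \<comment> \<open>The projection onto \<open>Q q\<close> is itself one of the homomorphisms
        whose kernels are intersected in \<open>C\<close>.\<close>
      then have "N q #> q = \<one>\<^bsub>Q q\<^esub>"
        using normal.r_coset_hom_Mod[OF N(1)[OF q]] q unfolding C_def Q_def by blast
      then have "N q #> q = N q" by (simp add: Q_def)
      then have "q \<in> N q"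
        using rcos_self[of q "N q"] normal_imp_subgroup[OF N(1)[OF q]] P(2) q by auto
      then show False using N(3)[OF q] by blast
    qed
    then show ?thesis by blast
  qed
  let ?R = "\<lambda>q. (\<lambda>f. restrict f (carrier G)) ` hom G (Q q)"
  \<comment> \<open>\<open>\<theta> x\<close> collects the values at \<open>x\<close> of all
    homomorphisms to the finite quotients. It takes finitely many values, and elements with the same
    value lie in the same coset of \<open>C\<close>; \<open>T\<close> picks one element per
    value.\<close>
  define \<theta> where "\<theta> x = (\<lambda>q\<in>P. \<lambda>f\<in>?R q. f x)" for x
  have "\<theta> ` carrier G \<subseteq> (\<Pi>\<^sub>E q\<in>P. \<Pi>\<^sub>E f\<in>?R q. carrier (Q q))"
    unfolding \<theta>_def by (auto simp: hom_def)
  moreover have "finite (\<Pi>\<^sub>E q\<in>P. \<Pi>\<^sub>E f\<in>?R q. carrier (Q q))"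
    by (intro finite_PiE P finite_homs fg Q) auto
  ultimately have fin: "finite (\<theta> ` carrier G)" by (rule finite_subset)
  define T where "T = inv_into (carrier G) \<theta> ` \<theta> ` carrier G"
  have TG: "T \<subseteq> carrier G" unfolding T_def by (auto intro: inv_into_into)
  have "\<exists>t\<in>T. x \<otimes> inv t \<in> C" if x: "x \<in> carrier G" for x
  proof -
    define t where "t = inv_into (carrier G) \<theta> (\<theta> x)"
    have t: "t \<in> T" "\<theta> t = \<theta> x" "t \<in> carrier G"
      using x by (auto simp: t_def T_def intro: inv_into_into f_inv_into_f)
    have "f (x \<otimes> inv t) = \<one>\<^bsub>Q q\<^esub>" if qf: "q \<in> P" "f \<in> hom G (Q q)" for q f
    proof -
      interpret group_hom G "Q q" f using gh qf by blast
      have "\<theta> t q (restrict f (carrier G)) = \<theta> x q (restrict f (carrier G))" using t(2) by simp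
      then have "f t = f x" using qf x t(3) by (simp add: \<theta>_def)
      then show ?thesis using x t(3) Q(1)[OF qf(1)] by (simp add: group.r_inv)
    qed
    then show ?thesis using t x by (auto simp: C_def)
  qed
  moreover have "\<alpha> c \<in> C" if a: "\<alpha> \<in> hom G G" and c: "c \<in> C" for \<alpha> c
  proof -
    \<comment> \<open>The composite of \<open>f\<close> after \<open>\<alpha>\<close> is again a
      homomorphism to \<open>Q q\<close>, so it kills \<open>c\<close>.\<close>
    have "f (\<alpha> c) = \<one>\<^bsub>Q q\<^esub>" if qf: "q \<in> P" "f \<in> hom G (Q q)" for q f
      using Cf[OF c qf(1) hom_compose[OF a qf(2)]] c CG by (simp add: compose_def subset_iff)
    moreover have "\<alpha> c \<in> carrier G" using a c by (auto simp: C_def hom_def)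
    ultimately show ?thesis by (auto simp: C_def)
  qed
  ultimately show ?thesis using that[OF sub disj] fin TG by (metis T_def finite_imageI)
qed

text \<open>Conjugation by an element of \<open>G\<close> restricts to an endomorphism of the normal
  image of \<open>K\<close>. A subgroup of \<open>K\<close> stable under all endomorphisms therefore
  has a normal image in \<open>G\<close>. The finite set \<open>T\<close> expresses finite
  index.\<close>

lemma normal_finite_index_avoiding:
  assumes K: "group K" and G: "group G" and fg: "finitely_generated K" and rf: "residually_finite K"
    and i: "i \<in> mon K G" and iK: "i ` carrier K \<lhd> G" and P: "finite P"
  obtains L T where "L \<lhd> G" "L \<subseteq> i ` carrier K" "L \<inter> P \<subseteq> {\<one>\<^bsub>G\<^esub>}" "finite T" "T \<subseteq> i ` carrier K"
    "\<And>x. x \<in> i ` carrier K \<Longrightarrow> \<exists>t\<in>T. \<exists>l\<in>L. x = l \<otimes>\<^bsub>G\<^esub> t"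
proof -
  interpret K: group K by fact
  interpret G: group G by fact
  interpret iK: normal "i ` carrier K" G by fact
  interpret i: group_hom K G i
    using i by (simp add: group_hom_def group_hom_axioms_def mon_def K.group_axioms G.group_axioms)
  have inj: "inj_on i (carrier K)" using i by (simp add: mon_def)
  define j where "j = inv_into (carrier K) i"
  have ij: "i (j x) = x" "j x \<in> carrier K" if "x \<in> i ` carrier K" for x
    using that by (auto simp: j_def f_inv_into_f inv_into_into)
  obtain C T where C: "subgroup C K" "C \<inter> {k \<in> carrier K. i k \<in> P - {\<one>\<^bsub>G\<^esub>}} = {}"
    and T: "finite T" "T \<subseteq> carrier K" "\<And>x. x \<in> carrier K \<Longrightarrow> \<exists>t\<in>T. x \<otimes>\<^bsub>K\<^esub> inv\<^bsub>K\<^esub> t \<in> C"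
    and inv: "\<And>\<alpha> c. \<alpha> \<in> hom K K \<Longrightarrow> c \<in> C \<Longrightarrow> \<alpha> c \<in> C"
  proof (rule K.residually_finite_fully_invariant[OF fg rf])
    have "{k \<in> carrier K. i k \<in> P - {\<one>\<^bsub>G\<^esub>}} = (i -` P \<inter> carrier K) - {\<one>\<^bsub>K\<^esub>}"
      using inj by (auto simp: inj_on_def)
    moreover have "finite (i -` P \<inter> carrier K)" using finite_vimage_IntI[OF P inj] .
    ultimately show "finite {k \<in> carrier K. i k \<in> P - {\<one>\<^bsub>G\<^esub>}}" by simp
  qed (use that in auto)
  have CK: "C \<subseteq> carrier K" using C(1) by (rule subgroup.subset)
  have "i ` C \<lhd> G"
    unfolding G.normal_inv_iff
  proof (intro conjI ballI)
    show "subgroup (i ` C) G" using C(1) by (rule i.subgroup_img_is_subgroup)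
    fix g x assume g: "g \<in> carrier G" and "x \<in> i ` C"
    then obtain c where c: "c \<in> C" "x = i c" by blast
    \<comment> \<open>This is conjugation by \<open>g\<close>, read in \<open>K\<close> through
      \<open>i\<close> and its inverse \<open>j\<close>.\<close>
    let ?\<alpha> = "\<lambda>k. j (g \<otimes>\<^bsub>G\<^esub> i k \<otimes>\<^bsub>G\<^esub> inv\<^bsub>G\<^esub> g)"
    have cl: "g \<otimes>\<^bsub>G\<^esub> i k \<otimes>\<^bsub>G\<^esub> inv\<^bsub>G\<^esub> g \<in> i ` carrier K" if "k \<in> carrier K" for k
      using that g iK.inv_op_closed2 by blast
    have "?\<alpha> \<in> hom K K"
    proof (rule homI)
      fix k k' assume k: "k \<in> carrier K" "k' \<in> carrier K"
      have "i (?\<alpha> (k \<otimes>\<^bsub>K\<^esub> k')) = i (?\<alpha> k \<otimes>\<^bsub>K\<^esub> ?\<alpha> k')"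
        using k g cl[OF k(1)] cl[OF k(2)] cl[OF K.m_closed[OF k]]
        by (simp add: ij G.m_assoc G.inv_solve_left flip: G.m_assoc[of "inv\<^bsub>G\<^esub> g" g])
      then show "?\<alpha> (k \<otimes>\<^bsub>K\<^esub> k') = ?\<alpha> k \<otimes>\<^bsub>K\<^esub> ?\<alpha> k'"
        by (rule inj_onD[OF inj]) (intro K.m_closed ij(2) cl k)+
    qed (use ij cl in auto)
    from inv[OF this c(1)] show "g \<otimes>\<^bsub>G\<^esub> x \<otimes>\<^bsub>G\<^esub> inv\<^bsub>G\<^esub> g \<in> i ` C"
      using ij(1)[OF cl[of c]] c CK by (metis image_eqI subsetD)
  qed
  moreover have "i ` C \<subseteq> i ` carrier K" using CK by blast
  moreover have "i ` C \<inter> P \<subseteq> {\<one>\<^bsub>G\<^esub>}" using C(2) CK by auto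
  moreover have "finite (i ` T)" "i ` T \<subseteq> i ` carrier K" using T by auto
  moreover have "\<exists>t\<in>i ` T. \<exists>l\<in>i ` C. x = l \<otimes>\<^bsub>G\<^esub> t" if x: "x \<in> i ` carrier K" for x
  proof -
    obtain k where k: "x = i k" "k \<in> carrier K" using x by blast
    then obtain t where t: "t \<in> T" "k \<otimes>\<^bsub>K\<^esub> inv\<^bsub>K\<^esub> t \<in> C" using T by blast
    have "x = i (k \<otimes>\<^bsub>K\<^esub> inv\<^bsub>K\<^esub> t) \<otimes>\<^bsub>G\<^esub> i t"
      using k t T(2) by (simp add: G.m_assoc subset_iff)
    then show ?thesis using t by blast
  qed
  ultimately show ?thesis by (rule that)
qed

subsection \<open>Uniform post-surjectivity\<close>

lemma asymptotic_iff:
  "asymptotic G x y \<longleftrightarrow> (\<exists>E. finite E \<and> E \<subseteq> carrier G \<and> (\<forall>g\<in>carrier G - E. x g = y g))"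
  unfolding asymptotic_def fun_eq_iff restrict_def by metis

lemma configs_in: "x \<in> configs G A \<Longrightarrow> g \<in> carrier G \<Longrightarrow> x g \<in> A"
  unfolding configs_def by auto

lemma configs_eqI:
  "x \<in> configs G A \<Longrightarrow> y \<in> configs G A \<Longrightarrow> (\<And>g. g \<in> carrier G \<Longrightarrow> x g = y g) \<Longrightarrow> x = y"
  unfolding configs_def by (rule PiE_ext)

lemma restrict_in_configs: "(\<And>g. g \<in> carrier G \<Longrightarrow> f g \<in> A) \<Longrightarrow> restrict f (carrier G) \<in> configs G A"
  unfolding configs_def by auto

text \<open>For a subgroup \<open>L\<close> these are the fixed points of the shift by
  \<open>L\<close>, that is, the functions on the cosets \<open>L g\<close>.\<close>

definition periodic_configs :: "('g, 'm) monoid_scheme \<Rightarrow> 'a set \<Rightarrow> 'g set \<Rightarrow> ('g \<Rightarrow> 'a) set" where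
  "periodic_configs G A L = {x \<in> configs G A. \<forall>l\<in>L. \<forall>g\<in>carrier G. x (l \<otimes>\<^bsub>G\<^esub> g) = x g}"

text \<open>The window of \<open>g\<close> is the translate \<open>g M\<close>, with the shift
  already unfolded. Requiring \<one> in \<open>M\<close> puts every site into its own
  window.\<close>

locale memory_automaton = group G for G :: "('g, 'm) monoid_scheme" (structure) +
  fixes A :: "'a set" and \<tau> :: "('g \<Rightarrow> 'a) \<Rightarrow> 'g \<Rightarrow> 'a" and M :: "'g set" and \<mu> :: "('g \<Rightarrow> 'a) \<Rightarrow> 'a"
  assumes finite_M: "finite M" and one_M: "\<one> \<in> M" and M_subset: "M \<subseteq> carrier G"
    and \<mu>_in: "\<mu> \<in> (M \<rightarrow>\<^sub>E A) \<rightarrow> A"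
    and \<tau>_local: "\<And>x g. x \<in> configs G A \<Longrightarrow> g \<in> carrier G \<Longrightarrow> \<tau> x g = \<mu> (\<lambda>m\<in>M. x (g \<otimes> m))"
    and \<tau>_configs: "\<And>x. x \<in> configs G A \<Longrightarrow> \<tau> x \<in> configs G A"

text \<open>Adding \<one> to a memory set is harmless: the new local map ignores the extra
  coordinate.\<close>

lemma (in group) cellular_automaton_memory:
  assumes "cellular_automaton G A \<tau>"
  obtains M \<mu> where "memory_automaton G A \<tau> M \<mu>"
proof -
  obtain M \<mu> where M: "finite M" "M \<subseteq> carrier G" "\<mu> \<in> (M \<rightarrow>\<^sub>E A) \<rightarrow> A"
    and \<mu>: "\<And>x g. x \<in> configs G A \<Longrightarrow> g \<in> carrier G \<Longrightarrow>
      \<tau> x g = \<mu> (restrict (shift G (inv g) x) M)" and cl: "\<tau> \<in> configs G A \<rightarrow> configs G A"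
    using assms unfolding cellular_automaton_def by blast
  have "memory_automaton G A \<tau> (insert \<one> M) (\<lambda>w. \<mu> (restrict w M))"
  proof
    show "(\<lambda>w. \<mu> (restrict w M)) \<in> (insert \<one> M \<rightarrow>\<^sub>E A) \<rightarrow> A"
    proof
      fix w assume "w \<in> insert \<one> M \<rightarrow>\<^sub>E A"
      then have "restrict w M \<in> M \<rightarrow>\<^sub>E A" by auto
      then show "\<mu> (restrict w M) \<in> A" using M(3) by blast
    qed
    fix x g assume x: "x \<in> configs G A" "g \<in> carrier G"
    have "restrict (shift G (inv g) x) M = restrict (\<lambda>m\<in>insert \<one> M. x (g \<otimes> m)) M"
      using M(2) x by (auto simp: fun_eq_iff shift_def restrict_def)
    then show "\<tau> x g = \<mu> (restrict (\<lambda>m\<in>insert \<one> M. x (g \<otimes> m)) M)" using \<mu>[OF x] by simp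
  qed (use M cl in auto)
  then show ?thesis by (rule that)
qed

section \<open>Locality and compactness\<close>

context memory_automaton
begin

text \<open>Allowing two different sites \<open>g\<close> and \<open>h\<close> covers shift
  equivariance as well as locality.\<close>

lemma \<tau>_cong:
  assumes "x \<in> configs G A" "y \<in> configs G A" "g \<in> carrier G" "h \<in> carrier G"
    and "\<And>m. m \<in> M \<Longrightarrow> x (g \<otimes> m) = y (h \<otimes> m)"
  shows "\<tau> x g = \<tau> y h"
proof -
  have "(\<lambda>m\<in>M. x (g \<otimes> m)) = (\<lambda>m\<in>M. y (h \<otimes> m))" using assms(5) by (rule restrict_ext)
  then show ?thesis by (simp add: \<tau>_local assms)
qed

lemma \<tau>_periodic:
  assumes "L \<subseteq> carrier G" "x \<in> periodic_configs G A L"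
  shows "\<tau> x \<in> periodic_configs G A L"
  unfolding periodic_configs_def
proof (intro CollectI conjI ballI)
  have x: "x \<in> configs G A" "\<And>l g. l \<in> L \<Longrightarrow> g \<in> carrier G \<Longrightarrow> x (l \<otimes> g) = x g"
    using assms(2) by (auto simp: periodic_configs_def)
  show "\<tau> x \<in> configs G A" using \<tau>_configs[OF x(1)] .
  fix l g assume lg: "l \<in> L" "g \<in> carrier G"
  have "x (l \<otimes> g \<otimes> m) = x (g \<otimes> m)" if "m \<in> M" for m
    using x(2)[OF lg(1), of "g \<otimes> m"] lg that assms(1) M_subset by (simp add: m_assoc subset_iff)
  then show "\<tau> x (l \<otimes> g) = \<tau> x g"
    using lg assms(1) by (intro \<tau>_cong x(1)) auto
qed

text \<open>The configurations are collected into a set for fixed \<open>E\<close> so that these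
  sets can serve as an open cover. Only the site \<one> is treated; equivariance handles the
  others.\<close>

definition repairable :: "'a \<Rightarrow> 'g set \<Rightarrow> ('g \<Rightarrow> 'a) set" where
  "repairable a E = {x \<in> configs G A. \<exists>z\<in>configs G A.
     (\<forall>g\<in>carrier G - E. z g = x g) \<and> \<tau> z = (\<tau> x)(\<one> := a)}"

lemma repairable_mono: "E \<subseteq> F \<Longrightarrow> repairable a E \<subseteq> repairable a F"
  unfolding repairable_def by blast

text \<open>Whether \<open>z\<close> repairs \<open>x\<close> is visible on a finite window
  \<open>W\<close>: if \<open>x'\<close> agrees with \<open>x\<close> there, then using
  \<open>z\<close> on \<open>E\<close> and \<open>x'\<close> elsewhere repairs
  \<open>x'\<close>.\<close>

lemma openin_repairable:
  assumes "finite E" "E \<subseteq> carrier G" "a \<in> A"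
  shows "openin (product_topology (\<lambda>_. discrete_topology A) (carrier G)) (repairable a E)"
    (is "openin ?X _")
proof (subst openin_subopen, intro ballI)
  fix x assume "x \<in> repairable a E"
  then obtain z where x: "x \<in> configs G A" and z: "z \<in> configs G A"
    "\<And>g. g \<in> carrier G \<Longrightarrow> g \<notin> E \<Longrightarrow> z g = x g" "\<tau> z = (\<tau> x)(\<one> := a)"
    unfolding repairable_def by blast
  \<comment> \<open>\<open>W\<close> contains the window of \<one> and every window that meets
    \<open>E\<close>, because \<open>g m = e\<close> gives \<open>g m' = e m^-1 m'\<close>. A window
    not inside \<open>W\<close> thus misses \<open>E\<close> and belongs to a site other than
    \<one>.\<close>
  define W where "W = M \<union> (\<lambda>(e, m, m'). e \<otimes> inv m \<otimes> m') ` (E \<times> M \<times> M)"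
  have W: "finite W" "W \<subseteq> carrier G"
    using assms finite_M M_subset by (auto simp: W_def subset_iff)
  define T where "T = (\<Pi>\<^sub>E g\<in>carrier G. if g \<in> W then {x g} else A)"
  have "openin ?X T"
    unfolding T_def openin_PiE_gen
  proof (intro disjI2 conjI ballI)
    show "finite {i \<in> carrier G. (if i \<in> W then {x i} else A) \<noteq> topspace (discrete_topology A)}"
      by (rule finite_subset[OF _ W(1)]) auto
  qed (use configs_in[OF x] in auto)
  moreover have "x \<in> T"
    using x configs_in[OF x] by (auto simp: T_def configs_def PiE_iff)
  moreover have "T \<subseteq> repairable a E"
  proof
    fix x' assume "x' \<in> T"
    then have x'A: "x' \<in> configs G A" and x'W: "\<And>g. g \<in> W \<Longrightarrow> x' g = x g"
      using W(2) configs_in[OF x] by (auto simp: T_def configs_def PiE_iff split: if_splits)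
    define z' where "z' = (\<lambda>g\<in>carrier G. if g \<in> E then z g else x' g)"
    have z'A: "z' \<in> configs G A"
      unfolding z'_def by (rule restrict_in_configs) (use configs_in z x'A in auto)
    have "\<tau> z' = (\<tau> x')(\<one> := a)"
    proof (rule configs_eqI[OF \<tau>_configs[OF z'A]])
      show "(\<tau> x')(\<one> := a) \<in> configs G A"
        using \<tau>_configs[OF x'A] \<open>a \<in> A\<close> by (auto simp: configs_def PiE_iff extensional_def)
      fix g assume g: "g \<in> carrier G"
      show "\<tau> z' g = ((\<tau> x')(\<one> := a)) g"
      proof (cases "\<forall>m\<in>M. g \<otimes> m \<in> W")
        case True
        have "\<tau> z' g = \<tau> z g"
          using True g W(2) x'W z(2) by (intro \<tau>_cong z'A z(1) g) (auto simp: z'_def)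
        moreover have "\<tau> x' g = \<tau> x g"
          using True x'W by (intro \<tau>_cong x'A x g) auto
        ultimately show ?thesis using z(3) by simp
      next
        case False
        have "g \<noteq> \<one>" using False M_subset by (auto simp: W_def)
        moreover have "g \<otimes> m \<notin> E" if m: "m \<in> M" for m
        proof
          assume e: "g \<otimes> m \<in> E"
          have "g \<otimes> m' \<in> W" if m': "m' \<in> M" for m'
          proof -
            have "g \<otimes> m' = (g \<otimes> m) \<otimes> inv m \<otimes> m'"
              using g m m' M_subset by (simp add: m_assoc subset_iff)
            then show ?thesis using e m m' unfolding W_def by force
          qed
          then show False using False by blast
        qed
        then have "\<tau> z' g = \<tau> x' g"
          using M_subset g by (intro \<tau>_cong z'A x'A g) (auto simp: z'_def)
        ultimately show ?thesis by simp
      qed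
    qed
    then show "x' \<in> repairable a E"
      unfolding repairable_def using x'A z'A by (auto simp: z'_def intro!: bexI[of _ z'])
  qed
  ultimately show "\<exists>T. openin ?X T \<and> x \<in> T \<and> T \<subseteq> repairable a E" by blast
qed

text \<open>For finite \<open>A\<close> the configuration space is compact. Post-surjectivity says
  that the open sets \<open>repairable a E\<close>, over all finite \<open>E\<close>, cover it; a
  finite subcover and the union over the finitely many symbols \<open>a\<close> give one
  \<open>E\<close>.\<close>

lemma uniform_post_surjective_at_one:
  assumes "finite A" "post_surjective G A \<tau>"
  obtains E where "finite E" "\<one> \<in> E" "E \<subseteq> carrier G"
    "\<And>x a. x \<in> configs G A \<Longrightarrow> a \<in> A \<Longrightarrow> x \<in> repairable a E"
proof -
  let ?X = "product_topology (\<lambda>_. discrete_topology A) (carrier G)"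
  let ?F = "{E. finite E \<and> E \<subseteq> carrier G}"
  have top: "topspace ?X = configs G A" by (simp add: configs_def)
  have comp: "compact_space ?X"
    using assms(1) by (simp add: compact_space_product_topology compact_space_discrete_topology)
  have "\<exists>E. E \<in> ?F \<and> configs G A \<subseteq> repairable a E" if a: "a \<in> A" for a
  proof -
    have cov: "configs G A \<subseteq> \<Union> (repairable a ` ?F)"
    proof
      fix x assume x: "x \<in> configs G A"
      have "(\<tau> x)(\<one> := a) \<in> configs G A"
        using \<tau>_configs[OF x] a by (auto simp: configs_def PiE_iff extensional_def)
      moreover have "asymptotic G ((\<tau> x)(\<one> := a)) (\<tau> x)"
        unfolding asymptotic_iff by (intro exI[of _ "{\<one>}"]) auto
      ultimately obtain z where z: "z \<in> configs G A" "asymptotic G z x" "\<tau> z = (\<tau> x)(\<one> := a)"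
        using assms(2) x unfolding post_surjective_def by blast
      then show "x \<in> \<Union> (repairable a ` ?F)"
        using x unfolding asymptotic_iff repairable_def by blast
    qed
    obtain \<V> where V: "finite \<V>" "\<V> \<subseteq> repairable a ` ?F" "configs G A \<subseteq> \<Union>\<V>"
    proof -
      have "\<forall>U\<in>repairable a ` ?F. openin ?X U" using openin_repairable a by blast
      then show ?thesis
        using that comp cov unfolding compact_space_alt top by meson
    qed
    obtain \<E> where E: "\<E> \<subseteq> ?F" "finite \<E>" "\<V> = repairable a ` \<E>"
      using finite_subset_image[OF V(1,2)] by blast
    have "\<Union>\<E> \<in> ?F" using E by auto
    moreover have "configs G A \<subseteq> repairable a (\<Union>\<E>)"
      using V(3) repairable_mono[of _ "\<Union>\<E>" a] unfolding E(3) by blast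
    ultimately show ?thesis by blast
  qed
  then obtain E where E: "\<And>a. a \<in> A \<Longrightarrow> E a \<in> ?F" "\<And>a. a \<in> A \<Longrightarrow> configs G A \<subseteq> repairable a (E a)"
    by metis
  show ?thesis
  proof
    show "x \<in> repairable a (insert \<one> (\<Union>(E ` A)))" if "x \<in> configs G A" "a \<in> A" for x a
      using E(2)[OF that(2)] that repairable_mono[of "E a" "insert \<one> (\<Union>(E ` A))" a] by blast
  qed (use E(1) assms(1) in auto)
qed

definition corrects_within :: "'g set \<Rightarrow> bool" where
  "corrects_within E \<longleftrightarrow> (\<forall>x\<in>configs G A. \<forall>a\<in>A. \<forall>h\<in>carrier G. \<exists>z\<in>configs G A.
     (\<forall>g\<in>carrier G - (\<otimes>) h ` E. z g = x g) \<and> \<tau> z = (\<tau> x)(h := a))"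

text \<open>By equivariance, a change at \<open>h\<close> is made by translating \<open>h\<close> to
  \<one>, repairing there and translating back.\<close>

lemma uniform_post_surjective:
  assumes "finite A" "post_surjective G A \<tau>"
  obtains E where "finite E" "\<one> \<in> E" "E \<subseteq> carrier G" "corrects_within E"
proof -
  obtain E where E: "finite E" "\<one> \<in> E" "E \<subseteq> carrier G"
    "\<And>x a. x \<in> configs G A \<Longrightarrow> a \<in> A \<Longrightarrow> x \<in> repairable a E"
    by (rule uniform_post_surjective_at_one[OF assms]) blast
  have "\<exists>z\<in>configs G A. (\<forall>g\<in>carrier G - (\<otimes>) h ` E. z g = x g) \<and> \<tau> z = (\<tau> x)(h := a)"
    if x: "x \<in> configs G A" and a: "a \<in> A" and h: "h \<in> carrier G" for x a h
  proof -
    define x' where "x' = (\<lambda>g\<in>carrier G. x (h \<otimes> g))"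
    have x': "x' \<in> configs G A"
      unfolding x'_def by (rule restrict_in_configs) (use configs_in[OF x] h in auto)
    obtain z' where z': "z' \<in> configs G A" "\<And>g. g \<in> carrier G \<Longrightarrow> g \<notin> E \<Longrightarrow> z' g = x' g"
        "\<tau> z' = (\<tau> x')(\<one> := a)"
      using E(4)[OF x' a] unfolding repairable_def by blast
    define z where "z = (\<lambda>g\<in>carrier G. z' (inv h \<otimes> g))"
    have z: "z \<in> configs G A"
      unfolding z_def by (rule restrict_in_configs) (use configs_in[OF z'(1)] h in auto)
    have "\<tau> z = (\<tau> x)(h := a)"
    proof (rule configs_eqI[OF \<tau>_configs[OF z]])
      show "(\<tau> x)(h := a) \<in> configs G A"
        using \<tau>_configs[OF x] a h by (auto simp: configs_def PiE_iff extensional_def)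
      fix g assume g: "g \<in> carrier G"
      have "\<tau> z g = \<tau> z' (inv h \<otimes> g)"
        using g h M_subset by (intro \<tau>_cong z z') (auto simp: z_def m_assoc subset_iff)
      moreover have "\<tau> x' (inv h \<otimes> g) = \<tau> x g"
        using g h M_subset by (intro \<tau>_cong x x') (auto simp: x'_def subset_iff m_assoc[symmetric])
      moreover have "inv h \<otimes> g = \<one> \<longleftrightarrow> g = h" using g h by (metis inv_closed inv_equality inv_inv l_inv)
      ultimately show "\<tau> z g = ((\<tau> x)(h := a)) g" using z'(3) by simp
    qed
    moreover have "z g = x g" if g: "g \<in> carrier G" "g \<notin> (\<otimes>) h ` E" for g
    proof -
      have eq: "h \<otimes> (inv h \<otimes> g) = g" using g h by (simp flip: m_assoc)
      then have "inv h \<otimes> g \<notin> E" using g by force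
      then show ?thesis using g h z'(2) eq by (simp add: z_def x'_def)
    qed
    ultimately show ?thesis using z by blast
  qed
  then have "corrects_within E" unfolding corrects_within_def by (intro ballI)
  then show ?thesis by (rule that[OF E(1-3)])
qed

end

subsection \<open>Periodic configurations\<close>

text \<open>When the windows through \<open>D\<close> of different \<open>L\<close>-translates of a site never meet, the window of
  \<open>periodize L D x w\<close> at any site is a translate of a window of \<open>w\<close>.\<close>

definition (in group) periodize :: "'a set \<Rightarrow> 'a set \<Rightarrow> ('a \<Rightarrow> 'c) \<Rightarrow> ('a \<Rightarrow> 'c) \<Rightarrow> 'a \<Rightarrow> 'c" where
  "periodize L D x w = (\<lambda>g\<in>carrier G. if \<exists>l\<in>L. l \<otimes> g \<in> D
     then w ((SOME l. l \<in> L \<and> l \<otimes> g \<in> D) \<otimes> g) else x g)"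

text \<open>When \<open>M\<close> contains \<one>, the case \<open>m = m' = \<one>\<close> makes the
  choice in \<open>periodize\<close> unique. Allowing arbitrary \<open>m\<close> and
  \<open>m'\<close> extends this uniqueness from sites to their windows.\<close>

definition (in group) separated :: "'a set \<Rightarrow> 'a set \<Rightarrow> 'a set \<Rightarrow> bool" where
  "separated M L D \<longleftrightarrow> (\<forall>g\<in>carrier G. \<forall>l\<in>L. \<forall>l'\<in>L. \<forall>m\<in>M. \<forall>m'\<in>M.
     l \<otimes> g \<otimes> m \<in> D \<longrightarrow> l' \<otimes> g \<otimes> m' \<in> D \<longrightarrow> l = l')"

text \<open>If \<open>l g m = h d\<close> and \<open>l' g m' = h d'\<close>, then conjugating
  \<open>l l'^-1\<close> by \<open>h\<close> gives \<open>d m^-1 m' d'^-1\<close>. By normality this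
  lies in \<open>L\<close>, hence it is \<one>. Conjugation removes \<open>h\<close>, so one
  condition on \<open>L\<close> serves all translates of \<open>D\<close>.\<close>

lemma (in group) separatedI:
  assumes L: "L \<lhd> G" and D: "D \<subseteq> carrier G" and M: "M \<subseteq> carrier G" and h: "h \<in> carrier G"
    and disj: "L \<inter> (\<lambda>(d, m, m', d'). d \<otimes> inv m \<otimes> m' \<otimes> inv d') ` (D \<times> M \<times> M \<times> D) \<subseteq> {\<one>}"
  shows "separated M L ((\<otimes>) h ` D)"
  unfolding separated_def
proof (intro ballI impI)
  interpret L: normal L G by fact
  fix g l l' m m' assume g: "g \<in> carrier G" and l: "l \<in> L" "l' \<in> L" and m: "m \<in> M" "m' \<in> M"
    and "l \<otimes> g \<otimes> m \<in> (\<otimes>) h ` D" "l' \<otimes> g \<otimes> m' \<in> (\<otimes>) h ` D"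
  then obtain d d' where d: "d \<in> D" "d' \<in> D" "l \<otimes> g \<otimes> m = h \<otimes> d" "l' \<otimes> g \<otimes> m' = h \<otimes> d'"
    by blast
  have c: "l \<in> carrier G" "l' \<in> carrier G" "m \<in> carrier G" "m' \<in> carrier G" "d \<in> carrier G" "d' \<in> carrier G"
    using l m d D M L.subset by auto
  have "l \<otimes> g = h \<otimes> d \<otimes> inv m" "l' \<otimes> g = h \<otimes> d' \<otimes> inv m'"
    using c g h d by (metis inv_solve_right m_closed)+
  then have l_eq: "l = h \<otimes> d \<otimes> inv m \<otimes> inv g" "l' = h \<otimes> d' \<otimes> inv m' \<otimes> inv g"
    using c g h by (metis inv_solve_right m_closed inv_closed)+
  have "inv h \<otimes> (l \<otimes> inv l') \<otimes> h = d \<otimes> inv m \<otimes> m' \<otimes> inv d'"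
    unfolding l_eq using c g h
    by (simp add: inv_mult_group m_assoc) (simp flip: m_assoc)
  moreover have "inv h \<otimes> (l \<otimes> inv l') \<otimes> h \<in> L"
    using l h by (intro L.inv_op_closed1) auto
  ultimately have "inv h \<otimes> (l \<otimes> inv l') \<otimes> h = \<one>"
    using disj d m by force
  then have "l \<otimes> inv l' = \<one>"
    using c h by (metis inv_closed inv_solve_left inv_solve_right l_one m_closed r_inv r_one)
  then show "l = l'" using c by (metis inv_equality inv_inv inv_closed)
qed

section \<open>Repeating a local change along \<open>L\<close>\<close>

context memory_automaton
begin

context
  fixes L D x
  assumes L: "subgroup L G" and D: "D \<subseteq> carrier G" and sep: "separated M L D"
    and x: "x \<in> periodic_configs G A L"
begin

lemma L_closed: "l \<in> L \<Longrightarrow> l \<in> carrier G"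
  using subgroup.subset[OF L] by blast

lemma periodize_at:
  assumes "g \<in> carrier G" "l \<in> L" "l \<otimes> g \<in> D"
  shows "periodize L D x w g = w (l \<otimes> g)"
proof -
  have "(SOME l. l \<in> L \<and> l \<otimes> g \<in> D) = l"
  proof (rule some_equality)
    fix k assume "k \<in> L \<and> k \<otimes> g \<in> D"
    then have "k \<in> L" "k \<otimes> g \<otimes> \<one> \<in> D" "l \<otimes> g \<otimes> \<one> \<in> D" using assms L_closed by auto
    then show "k = l" using sep assms(1,2) one_M unfolding separated_def by blast
  qed (use assms in auto)
  then show ?thesis using assms by (auto simp: periodize_def)
qed

lemma periodize_off:
  "g \<in> carrier G \<Longrightarrow> (\<And>l. l \<in> L \<Longrightarrow> l \<otimes> g \<notin> D) \<Longrightarrow> periodize L D x w g = x g"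
  by (auto simp: periodize_def)

text \<open>If \<open>k\<close> moves \<open>l g\<close> into \<open>D\<close>, then
  \<open>k l\<close> moves \<open>g\<close> to the same point of \<open>D\<close>, so both sites
  read the same value of \<open>w\<close>. On orbits that miss \<open>D\<close>, the periodicity of
  \<open>x\<close> is used.\<close>

lemma periodize_periodic:
  assumes w: "w \<in> configs G A"
  shows "periodize L D x w \<in> periodic_configs G A L"
  unfolding periodic_configs_def
proof (intro CollectI conjI ballI)
  have xc: "x \<in> configs G A" "\<And>l g. l \<in> L \<Longrightarrow> g \<in> carrier G \<Longrightarrow> x (l \<otimes> g) = x g"
    using x by (auto simp: periodic_configs_def)
  have "periodize L D x w g \<in> A" if g: "g \<in> carrier G" for g
  proof (cases "\<exists>l\<in>L. l \<otimes> g \<in> D")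
    case True
    then obtain l where l: "l \<in> L" "l \<otimes> g \<in> D" by blast
    then show ?thesis using configs_in[OF w] D g by (simp add: periodize_at[OF g l] subset_iff)
  next
    case False
    then show ?thesis using configs_in[OF xc(1) g] periodize_off[OF g] by metis
  qed
  then show "periodize L D x w \<in> configs G A"
    by (auto simp: configs_def PiE_iff periodize_def)
  fix l g assume l: "l \<in> L" and g: "g \<in> carrier G"
  have lg: "l \<otimes> g \<in> carrier G" using l g L_closed by simp
  have shift_eq: "k \<otimes> (l \<otimes> g) = k \<otimes> l \<otimes> g" "k \<otimes> l \<in> L" if "k \<in> L" for k
    using that l g L_closed L by (auto simp: m_assoc subgroup.m_closed)
  show "periodize L D x w (l \<otimes> g) = periodize L D x w g"
  proof (cases "\<exists>k\<in>L. k \<otimes> (l \<otimes> g) \<in> D")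
    case True
    then obtain k where k: "k \<in> L" "k \<otimes> (l \<otimes> g) \<in> D" by blast
    then show ?thesis using periodize_at[OF lg k] periodize_at[OF g, of "k \<otimes> l"] shift_eq[OF k(1)] by simp
  next
    case False
    have "k \<otimes> g \<notin> D" if k: "k \<in> L" for k
    proof -
      have "k \<otimes> inv l \<in> L" using k l L by (simp add: subgroup.m_closed subgroup.m_inv_closed)
      moreover have "k \<otimes> inv l \<otimes> (l \<otimes> g) = k \<otimes> g"
        using k l g L_closed by (simp add: m_assoc) (simp flip: m_assoc)
      ultimately show ?thesis using False by metis
    qed
    then show ?thesis
      using False periodize_off[OF g] periodize_off[OF lg] xc(2)[OF l g] by metis
  qed
qed

text \<open>At most one translate of \<open>g\<close> has a window meeting \<open>D\<close>;
  \<open>l\<close> selects it, and the periodized configuration near \<open>g\<close> looks like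
  \<open>w\<close> near \<open>l g\<close>. The same \<open>l\<close> serves every \<open>w\<close>
  that agrees with \<open>x\<close> off \<open>D\<close>, which allows two such configurations to be
  compared.\<close>

lemma periodize_local:
  assumes g: "g \<in> carrier G"
  obtains l where "l \<in> L" "\<And>k. k \<in> L \<Longrightarrow> k \<otimes> g \<in> D \<Longrightarrow> l = k"
    "\<And>w. w \<in> configs G A \<Longrightarrow> (\<And>h. h \<in> carrier G \<Longrightarrow> h \<notin> D \<Longrightarrow> w h = x h) \<Longrightarrow>
       \<tau> (periodize L D x w) g = \<tau> w (l \<otimes> g)"
proof -
  have xp: "x (l \<otimes> h) = x h" if "l \<in> L" "h \<in> carrier G" for l h
    using x that by (auto simp: periodic_configs_def)
  obtain l where l: "l \<in> L"
    and uniq: "\<And>k m. k \<in> L \<Longrightarrow> m \<in> M \<Longrightarrow> k \<otimes> (g \<otimes> m) \<in> D \<Longrightarrow> l = k"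
  proof (cases "\<exists>k\<in>L. \<exists>m\<in>M. k \<otimes> (g \<otimes> m) \<in> D")
    case True
    then obtain l m where l: "l \<in> L" "m \<in> M" "l \<otimes> g \<otimes> m \<in> D"
      using g M_subset L_closed by (auto simp: m_assoc)
    show ?thesis
    proof (rule that[OF l(1)])
      fix k m' assume k: "k \<in> L" "m' \<in> M" "k \<otimes> (g \<otimes> m') \<in> D"
      then have "k \<otimes> g \<otimes> m' \<in> D" using g M_subset L_closed by (simp add: m_assoc subset_iff)
      then show "l = k" using sep g l k unfolding separated_def by blast
    qed
  next
    \<comment> \<open>If no translated window meets \<open>D\<close>, any element of
      \<open>L\<close> works; \<one> is taken.\<close>
    case False
    then show ?thesis using that[OF subgroup.one_closed[OF L]] by blast
  qed
  show ?thesis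
  proof (rule that[OF l])
    show "l = k" if "k \<in> L" "k \<otimes> g \<in> D" for k
      using uniq[OF that(1) one_M] that g L_closed by simp
    fix w assume w: "w \<in> configs G A" "\<And>h. h \<in> carrier G \<Longrightarrow> h \<notin> D \<Longrightarrow> w h = x h"
    show "\<tau> (periodize L D x w) g = \<tau> w (l \<otimes> g)"
    proof (rule \<tau>_cong)
      show "periodize L D x w \<in> configs G A"
        using periodize_periodic[OF w(1)] by (auto simp: periodic_configs_def)
      fix m assume m: "m \<in> M"
      have c: "g \<otimes> m \<in> carrier G" "l \<in> carrier G" "m \<in> carrier G" using g m l M_subset L_closed by auto
      have a: "l \<otimes> g \<otimes> m = l \<otimes> (g \<otimes> m)" using c g by (simp add: m_assoc)
      show "periodize L D x w (g \<otimes> m) = w (l \<otimes> g \<otimes> m)"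
      proof (cases "l \<otimes> (g \<otimes> m) \<in> D")
        case True
        then show ?thesis using periodize_at[OF c(1) l] a by simp
      next
        case False
        then have "k \<otimes> (g \<otimes> m) \<notin> D" if "k \<in> L" for k using uniq[OF that m] by blast
        \<comment> \<open>Off \<open>D\<close> both sides are values of \<open>x\<close>, at
          \<open>g m\<close> and at \<open>l g m\<close>; these agree by periodicity.\<close>
        then show ?thesis
          using periodize_off[OF c(1)] False w(2)[of "l \<otimes> (g \<otimes> m)"] xp[OF l c(1)] c a by simp
      qed
    qed (use w g l L_closed in auto)
  qed
qed

end

text \<open>The site \<open>h\<close> is corrected once, forgetting periodicity, and the corrected
  patch is then repeated along \<open>L\<close>. Separation keeps the copies from
  interacting.\<close>

lemma periodic_correct_at:
  assumes L: "L \<lhd> G" and E: "E \<subseteq> carrier G" "\<one> \<in> E"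
    and unif: "corrects_within E"
    and disj: "L \<inter> (\<lambda>(d, m, m', d'). d \<otimes> inv m \<otimes> m' \<otimes> inv d') ` (E \<times> M \<times> M \<times> E) \<subseteq> {\<one>}"
    and x: "x \<in> periodic_configs G A L" and a: "a \<in> A" and h: "h \<in> carrier G"
  obtains z where "z \<in> periodic_configs G A L"
    "\<And>g. g \<in> carrier G \<Longrightarrow> (\<And>l. l \<in> L \<Longrightarrow> l \<otimes> g \<notin> (\<otimes>) h ` E) \<Longrightarrow> z g = x g"
    "\<And>g. g \<in> carrier G \<Longrightarrow> \<tau> z g = (if \<exists>l\<in>L. l \<otimes> g = h then a else \<tau> x g)"
proof -
  let ?D = "(\<otimes>) h ` E"
  have Ls: "subgroup L G" using L by (rule normal_imp_subgroup)
  have D: "?D \<subseteq> carrier G" using E h by auto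
  have sep: "separated M L ?D" by (rule separatedI[OF L E(1) M_subset h disj])
  have xc: "x \<in> configs G A" using x by (simp add: periodic_configs_def)
  obtain w where w: "w \<in> configs G A" "\<And>g. g \<in> carrier G \<Longrightarrow> g \<notin> ?D \<Longrightarrow> w g = x g"
      "\<tau> w = (\<tau> x)(h := a)"
    using bspec[OF bspec[OF bspec[OF unif[unfolded corrects_within_def] xc] a] h] by blast
  have hD: "h \<in> ?D" using E(2) h by force
  note ctxt = Ls D sep x
  show ?thesis
  proof (rule that[of "periodize L ?D x w"])
    show "periodize L ?D x w \<in> periodic_configs G A L" by (rule periodize_periodic[OF ctxt w(1)])
    show "periodize L ?D x w g = x g" if "g \<in> carrier G" "\<And>l. l \<in> L \<Longrightarrow> l \<otimes> g \<notin> ?D" for g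
      by (rule periodize_off[OF ctxt that])
    fix g assume g: "g \<in> carrier G"
    obtain l where l: "l \<in> L" "\<And>k. k \<in> L \<Longrightarrow> k \<otimes> g \<in> ?D \<Longrightarrow> l = k"
      "\<tau> (periodize L ?D x w) g = \<tau> w (l \<otimes> g)"
      using periodize_local[OF ctxt g] w(1,2) by metis
    have "\<tau> x (l \<otimes> g) = \<tau> x g"
      using \<tau>_periodic[OF subgroup.subset[OF Ls] x] l(1) g by (auto simp: periodic_configs_def)
    \<comment> \<open>Since \<open>h\<close> lies in the patch, an element of \<open>L\<close>
      moving \<open>g\<close> to \<open>h\<close> must be the selected \<open>l\<close>.\<close>
    moreover have "(\<exists>k\<in>L. k \<otimes> g = h) \<longleftrightarrow> l \<otimes> g = h" using l(1,2) hD by metis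
    ultimately show "\<tau> (periodize L ?D x w) g = (if \<exists>l\<in>L. l \<otimes> g = h then a else \<tau> x g)"
      using l(3) w(3) by simp
  qed
qed

text \<open>One orbit of \<open>L\<close> is corrected at a time, by induction on \<open>F\<close>.
  Being asymptotic is replaced by differing on finitely many orbits of \<open>L\<close>, the notion
  that fits periodic configurations.\<close>

lemma periodic_correct:
  assumes L: "L \<lhd> G" and E: "finite E" "E \<subseteq> carrier G" "\<one> \<in> E"
    and unif: "corrects_within E"
    and disj: "L \<inter> (\<lambda>(d, m, m', d'). d \<otimes> inv m \<otimes> m' \<otimes> inv d') ` (E \<times> M \<times> M \<times> E) \<subseteq> {\<one>}"
    and x: "x \<in> periodic_configs G A L"
    and F: "finite F" "F \<subseteq> carrier G"
    and y: "y \<in> periodic_configs G A L"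
      "\<And>g. g \<in> carrier G \<Longrightarrow> (\<And>l. l \<in> L \<Longrightarrow> l \<otimes> g \<notin> F) \<Longrightarrow> y g = \<tau> x g"
  shows "\<exists>z\<in>periodic_configs G A L. \<exists>E'. finite E' \<and> E' \<subseteq> carrier G \<and>
    (\<forall>g\<in>carrier G. (\<forall>l\<in>L. l \<otimes> g \<notin> E') \<longrightarrow> z g = x g) \<and> \<tau> z = y"
  using F y
proof (induction F arbitrary: y rule: finite_induct)
  case empty
  have "\<tau> x \<in> configs G A" "y \<in> configs G A"
    using \<tau>_configs x empty by (auto simp: periodic_configs_def)
  then have "\<tau> x = y" by (rule configs_eqI) (use empty in auto)
  then show ?case using x by (intro bexI[of _ x] exI[of _ "{}"]) auto
next
  case (insert h F)
  have Ls: "subgroup L G" using L by (rule normal_imp_subgroup)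
  have LG: "L \<subseteq> carrier G" by (rule subgroup.subset[OF Ls])
  have h: "h \<in> carrier G" "F \<subseteq> carrier G" using insert.prems by auto
  have yc: "y \<in> configs G A" "\<And>l g. l \<in> L \<Longrightarrow> g \<in> carrier G \<Longrightarrow> y (l \<otimes> g) = y g"
    using insert.prems by (auto simp: periodic_configs_def)
  have \<tau>x: "\<tau> x \<in> configs G A" "\<And>l g. l \<in> L \<Longrightarrow> g \<in> carrier G \<Longrightarrow> \<tau> x (l \<otimes> g) = \<tau> x g"
    using \<tau>_periodic[OF LG x] by (auto simp: periodic_configs_def)
  have orbit: "(\<exists>k\<in>L. k \<otimes> (l \<otimes> g) = h) \<longleftrightarrow> (\<exists>k\<in>L. k \<otimes> g = h)" if l: "l \<in> L" "g \<in> carrier G" for l g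
  proof
    assume "\<exists>k\<in>L. k \<otimes> (l \<otimes> g) = h"
    then show "\<exists>k\<in>L. k \<otimes> g = h"
      using l LG subgroup.m_closed[OF Ls] by (metis m_assoc subsetD)
  next
    assume "\<exists>k\<in>L. k \<otimes> g = h"
    then obtain k where k: "k \<in> L" "k \<otimes> g = h" by blast
    have "k \<otimes> inv l \<otimes> (l \<otimes> g) = h"
      using k l LG by (simp add: m_assoc subset_iff) (simp flip: m_assoc)
    then show "\<exists>k\<in>L. k \<otimes> (l \<otimes> g) = h"
      using k l Ls by (metis subgroup.m_closed subgroup.m_inv_closed)
  qed
  \<comment> \<open>The target is reset to \<open>\<tau> x\<close> on the orbit of \<open>h\<close>,
    so the induction hypothesis for \<open>F\<close> reaches \<open>y'\<close>; this last orbit is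
    corrected afterwards.\<close>
  define y' where "y' = (\<lambda>g\<in>carrier G. if \<exists>k\<in>L. k \<otimes> g = h then \<tau> x g else y g)"
  have "y' \<in> periodic_configs G A L"
    unfolding periodic_configs_def
  proof (intro CollectI conjI ballI)
    show "y' \<in> configs G A"
      unfolding y'_def by (rule restrict_in_configs) (use configs_in \<tau>x yc in auto)
    fix l g assume "l \<in> L" "g \<in> carrier G"
    then show "y' (l \<otimes> g) = y' g"
      using LG by (simp add: y'_def orbit \<tau>x yc subset_iff)
  qed
  moreover have "y' g = \<tau> x g" if g: "g \<in> carrier G" "\<And>l. l \<in> L \<Longrightarrow> l \<otimes> g \<notin> F" for g
    using insert.prems(3)[OF g(1)] g by (auto simp: y'_def)
  ultimately obtain z' E' where z': "z' \<in> periodic_configs G A L" "finite E'" "E' \<subseteq> carrier G"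
      "\<And>g. g \<in> carrier G \<Longrightarrow> (\<forall>l\<in>L. l \<otimes> g \<notin> E') \<Longrightarrow> z' g = x g" "\<tau> z' = y'"
    using insert.IH[OF h(2), of y'] by blast
  obtain z where z: "z \<in> periodic_configs G A L"
    "\<And>g. g \<in> carrier G \<Longrightarrow> (\<And>l. l \<in> L \<Longrightarrow> l \<otimes> g \<notin> (\<otimes>) h ` E) \<Longrightarrow> z g = z' g"
    "\<And>g. g \<in> carrier G \<Longrightarrow> \<tau> z g = (if \<exists>l\<in>L. l \<otimes> g = h then y h else \<tau> z' g)"
    by (rule periodic_correct_at[OF L E(2,3) unif disj z'(1) configs_in[OF yc(1) h(1)] h(1)]) blast+
  have "\<tau> z = y"
  proof (rule configs_eqI[OF _ yc(1)])
    show "\<tau> z \<in> configs G A" using \<tau>_configs z(1) by (simp add: periodic_configs_def)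
    fix g assume g: "g \<in> carrier G"
    show "\<tau> z g = y g"
    proof (cases "\<exists>l\<in>L. l \<otimes> g = h")
      case True
      then show ?thesis using z(3)[OF g] yc(2) g by auto
    next
      case False
      then show ?thesis using z(3)[OF g] z'(5) g by (simp add: y'_def)
    qed
  qed
  moreover have "z g = x g" if "g \<in> carrier G" "\<forall>l\<in>L. l \<otimes> g \<notin> E' \<union> (\<otimes>) h ` E" for g
    using that z(2)[of g] z'(4)[of g] by auto
  ultimately show ?case
    using z(1) z'(2,3) E(1,2) h(1) by (intro bexI[of _ z] exI[of _ "E' \<union> (\<otimes>) h ` E"]) auto
qed

end

subsection \<open>Periodic configurations on a split extension\<close>

text \<open>Splitting \<open>G\<close> as \<open>s ` H\<close> times the kernel, an \<open>L\<close>-periodic configuration on \<open>G\<close> is a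
  configuration on \<open>H\<close> whose symbols are \<open>L\<close>-periodic maps on the kernel.\<close>

locale split_automaton = memory_automaton G A \<tau> M \<mu> + H: group H + p: group_hom G H p + s: group_hom H G s
  for G :: "('g, 'm) monoid_scheme" (structure) and A :: "'a set" and \<tau> M \<mu>
    and H :: "('h, 'n) monoid_scheme" and p :: "'g \<Rightarrow> 'h" and s :: "'h \<Rightarrow> 'g" +
  fixes L T :: "'g set"
  assumes ps: "\<And>h. h \<in> carrier H \<Longrightarrow> p (s h) = h"
    and L: "L \<lhd> G" and L_kernel: "L \<subseteq> kernel G H p"
    and T: "finite T" "T \<subseteq> kernel G H p" "\<And>k. k \<in> kernel G H p \<Longrightarrow> \<exists>t\<in>T. \<exists>l\<in>L. k = l \<otimes> t"
begin

section \<open>Translation between \<open>G\<close> and \<open>H\<close>\<close>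

definition blocks :: "('g \<Rightarrow> 'a) set" where
  "blocks = {b \<in> kernel G H p \<rightarrow>\<^sub>E A. \<forall>l\<in>L. \<forall>k\<in>kernel G H p. b (l \<otimes> k) = b k}"

definition to_blocks :: "('g \<Rightarrow> 'a) \<Rightarrow> 'h \<Rightarrow> 'g \<Rightarrow> 'a" where
  "to_blocks x = (\<lambda>h\<in>carrier H. \<lambda>k\<in>kernel G H p. x (s h \<otimes> k))"

text \<open>The inverse of \<open>to_blocks\<close>, from the unique factorization of
  \<open>g\<close> as \<open>s (p g)\<close> times an element of the kernel.\<close>

definition of_blocks :: "('h \<Rightarrow> 'g \<Rightarrow> 'a) \<Rightarrow> 'g \<Rightarrow> 'a" where
  "of_blocks u = (\<lambda>g\<in>carrier G. u (p g) (inv (s (p g)) \<otimes> g))"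

definition block_automaton :: "('h \<Rightarrow> 'g \<Rightarrow> 'a) \<Rightarrow> 'h \<Rightarrow> 'g \<Rightarrow> 'a" where
  "block_automaton u = to_blocks (\<tau> (of_blocks u))"

lemma mem_kernel: "k \<in> kernel G H p \<longleftrightarrow> k \<in> carrier G \<and> p k = \<one>\<^bsub>H\<^esub>"
  by (simp add: kernel_def)

lemma L_mem: "l \<in> L \<Longrightarrow> l \<in> carrier G" "l \<in> L \<Longrightarrow> p l = \<one>\<^bsub>H\<^esub>"
  using L_kernel by (auto simp: mem_kernel)

lemma L_carrier: "L \<subseteq> carrier G"
  using L_mem by blast

lemma kernel_part: "g \<in> carrier G \<Longrightarrow> inv (s (p g)) \<otimes> g \<in> kernel G H p"
  by (simp add: mem_kernel ps)

text \<open>Periodicity is invariance on the left, while block coordinates put the kernel element to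
  the right of \<open>s h\<close>. Normality of \<open>L\<close> moves \<open>l\<close> across
  \<open>g\<close>.\<close>

lemma periodic_right:
  assumes x: "x \<in> periodic_configs G A L" and l: "l \<in> L" and g: "g \<in> carrier G" "h \<in> carrier G"
  shows "x (g \<otimes> (l \<otimes> h)) = x (g \<otimes> h)"
proof -
  have "g \<otimes> l \<otimes> inv g \<in> L" using normal.inv_op_closed2[OF L g(1) l] .
  moreover have "g \<otimes> (l \<otimes> h) = g \<otimes> l \<otimes> inv g \<otimes> (g \<otimes> h)"
    using g l L_mem by (simp add: m_assoc) (simp flip: m_assoc)
  ultimately show ?thesis using x g by (simp add: periodic_configs_def)
qed

lemma blocks_right:
  assumes b: "b \<in> blocks" and l: "l \<in> L" and g: "g \<in> carrier G" "h \<in> carrier G" and gh: "g \<otimes> h \<in> kernel G H p"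
  shows "b (g \<otimes> (l \<otimes> h)) = b (g \<otimes> h)"
proof -
  have "g \<otimes> l \<otimes> inv g \<in> L" using normal.inv_op_closed2[OF L g(1) l] .
  moreover have "g \<otimes> (l \<otimes> h) = g \<otimes> l \<otimes> inv g \<otimes> (g \<otimes> h)"
    using g l L_mem by (simp add: m_assoc) (simp flip: m_assoc)
  ultimately show ?thesis using b gh by (simp add: blocks_def)
qed

text \<open>\<open>T\<close> meets every coset of \<open>L\<close> in the kernel, so a block is
  determined by its values on the finite set \<open>T\<close>.\<close>

lemma finite_blocks:
  assumes "finite A"
  shows "finite blocks"
proof (rule inj_on_finite)
  show "inj_on (\<lambda>b. restrict b T) blocks"
  proof (rule inj_onI)
    fix b c assume b: "b \<in> blocks" and c: "c \<in> blocks" and eq: "restrict b T = restrict c T"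
    have bc: "b \<in> kernel G H p \<rightarrow>\<^sub>E A" "c \<in> kernel G H p \<rightarrow>\<^sub>E A" using b c by (auto simp: blocks_def)
    show "b = c"
    proof (rule PiE_ext[OF bc])
      fix k assume "k \<in> kernel G H p"
      then obtain t l where t: "t \<in> T" "l \<in> L" "k = l \<otimes> t" using T(3) by blast
      have "b t = c t" using eq t(1) by (metis restrict_apply')
      then show "b k = c k" using b c t T(2) by (simp add: blocks_def subset_iff)
    qed
  qed
  show "(\<lambda>b. restrict b T) ` blocks \<subseteq> T \<rightarrow>\<^sub>E A" using T(2) by (auto simp: blocks_def)
  show "finite (T \<rightarrow>\<^sub>E A)" using T(1) assms by (intro finite_PiE) auto
qed

lemma to_blocks_configs:
  assumes x: "x \<in> periodic_configs G A L"
  shows "to_blocks x \<in> configs H blocks"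
  unfolding to_blocks_def
proof (rule restrict_in_configs)
  fix h assume h: "h \<in> carrier H"
  have "x (s h \<otimes> (l \<otimes> k)) = x (s h \<otimes> k)" if "l \<in> L" "k \<in> kernel G H p" for l k
    using periodic_right[OF x that(1)] h that by (simp add: mem_kernel)
  moreover have "l \<otimes> k \<in> kernel G H p" if "l \<in> L" "k \<in> kernel G H p" for l k
    using that L_mem by (simp add: mem_kernel)
  moreover have "x (s h \<otimes> k) \<in> A" if "k \<in> kernel G H p" for k
    using x h that configs_in[of x G A] by (simp add: mem_kernel periodic_configs_def)
  ultimately show "(\<lambda>k\<in>kernel G H p. x (s h \<otimes> k)) \<in> blocks"
    by (auto simp: blocks_def)
qed

lemma of_blocks_periodic:
  assumes u: "u \<in> configs H blocks"
  shows "of_blocks u \<in> periodic_configs G A L"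
  unfolding periodic_configs_def
proof (intro CollectI conjI ballI)
  have u_blocks: "u (p g) \<in> blocks" if "g \<in> carrier G" for g
    using configs_in[OF u] that by simp
  show "of_blocks u \<in> configs G A"
    unfolding of_blocks_def
  proof (rule restrict_in_configs)
    fix g assume g: "g \<in> carrier G"
    then have "u (p g) \<in> kernel G H p \<rightarrow>\<^sub>E A" using u_blocks by (simp add: blocks_def)
    then show "u (p g) (inv (s (p g)) \<otimes> g) \<in> A" using kernel_part[OF g] by (rule PiE_mem)
  qed
  fix l g assume l: "l \<in> L" and g: "g \<in> carrier G"
  have "u (p g) (inv (s (p g)) \<otimes> (l \<otimes> g)) = u (p g) (inv (s (p g)) \<otimes> g)"
    using g by (intro blocks_right u_blocks l kernel_part) auto
  then show "of_blocks u (l \<otimes> g) = of_blocks u g"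
    using l g L_mem by (simp add: of_blocks_def)
qed

lemma of_to_blocks:
  assumes x: "x \<in> configs G A"
  shows "of_blocks (to_blocks x) = x"
proof
  fix g
  show "of_blocks (to_blocks x) g = x g"
  proof (cases "g \<in> carrier G")
    case True
    have "s (p g) \<otimes> (inv (s (p g)) \<otimes> g) = g" using True by (simp flip: m_assoc)
    then show ?thesis using True kernel_part[OF True] by (simp add: of_blocks_def to_blocks_def)
  next
    case False
    then show ?thesis using x by (simp add: of_blocks_def configs_def PiE_iff extensional_def)
  qed
qed

lemma to_of_blocks:
  assumes u: "u \<in> configs H blocks"
  shows "to_blocks (of_blocks u) = u"
proof (rule configs_eqI[OF to_blocks_configs[OF of_blocks_periodic[OF u]] u])
  fix h assume h: "h \<in> carrier H"
  have b: "u h \<in> kernel G H p \<rightarrow>\<^sub>E A" using configs_in[OF u h] by (simp add: blocks_def)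
  show "to_blocks (of_blocks u) h = u h"
  proof
    fix k
    show "to_blocks (of_blocks u) h k = u h k"
    proof (cases "k \<in> kernel G H p")
      case True
      have "inv (s h) \<otimes> (s h \<otimes> k) = k" using h True by (simp add: mem_kernel flip: m_assoc)
      then show ?thesis using h True by (simp add: to_blocks_def of_blocks_def mem_kernel ps)
    next
      case False
      then show ?thesis using b h by (simp add: to_blocks_def PiE_iff extensional_def)
    qed
  qed
qed

text \<open>The site \<open>s h k m\<close> has \<open>H\<close>-coordinate \<open>h (p m)\<close>
  and kernel coordinate \<open>s (p m)^-1 k m\<close>. The latter does not involve \<open>h\<close>
  because \<open>s\<close> is a homomorphism, so one local rule on the image of \<open>M\<close>
  under \<open>p\<close> serves all of \<open>H\<close>.\<close>

lemma block_automaton_cellular: "cellular_automaton H blocks block_automaton"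
  unfolding cellular_automaton_def
proof (intro conjI exI ballI)
  show "block_automaton \<in> configs H blocks \<rightarrow> configs H blocks"
    by (auto simp: block_automaton_def intro!: to_blocks_configs \<tau>_periodic[OF L_carrier] of_blocks_periodic)
  let ?\<nu> = "\<lambda>w. \<lambda>k\<in>kernel G H p. \<mu> (\<lambda>m\<in>M. w (p m) (inv (s (p m)) \<otimes> (k \<otimes> m)))"
  show "finite (p ` M)" "p ` M \<subseteq> carrier H" using finite_M M_subset by auto
  have km: "inv (s (p m)) \<otimes> (k \<otimes> m) \<in> kernel G H p" if "k \<in> kernel G H p" "m \<in> M" for k m
    using that M_subset by (auto simp: mem_kernel ps)
  show "?\<nu> \<in> (p ` M \<rightarrow>\<^sub>E blocks) \<rightarrow> blocks"
  proof
    fix w assume w: "w \<in> p ` M \<rightarrow>\<^sub>E blocks"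
    have wm: "w (p m) \<in> blocks" if "m \<in> M" for m using w that by auto
    have "\<mu> (\<lambda>m\<in>M. w (p m) (inv (s (p m)) \<otimes> (k \<otimes> m))) \<in> A" if "k \<in> kernel G H p" for k
    proof -
      have "(\<lambda>m\<in>M. w (p m) (inv (s (p m)) \<otimes> (k \<otimes> m))) \<in> M \<rightarrow>\<^sub>E A"
        using km[OF that] wm by (auto simp: blocks_def)
      then show ?thesis using \<mu>_in by blast
    qed
    moreover have "(\<lambda>m\<in>M. w (p m) (inv (s (p m)) \<otimes> (l \<otimes> k \<otimes> m))) =
        (\<lambda>m\<in>M. w (p m) (inv (s (p m)) \<otimes> (k \<otimes> m)))" if l: "l \<in> L" and k: "k \<in> kernel G H p" for l k
    proof (rule restrict_ext)
      fix m assume m: "m \<in> M"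
      have c: "m \<in> carrier G" "k \<in> carrier G" using m M_subset k by (auto simp: mem_kernel)
      have "w (p m) (inv (s (p m)) \<otimes> (l \<otimes> (k \<otimes> m))) = w (p m) (inv (s (p m)) \<otimes> (k \<otimes> m))"
        using c by (intro blocks_right wm m l km k) auto
      then show "w (p m) (inv (s (p m)) \<otimes> (l \<otimes> k \<otimes> m)) = w (p m) (inv (s (p m)) \<otimes> (k \<otimes> m))"
        using c l L_mem by (simp add: m_assoc)
    qed
    moreover have "l \<otimes> k \<in> kernel G H p" if "l \<in> L" "k \<in> kernel G H p" for l k
      using that L_mem by (simp add: mem_kernel)
    ultimately show "?\<nu> w \<in> blocks" by (auto simp: blocks_def)
  qed
  fix u h assume u: "u \<in> configs H blocks" and h: "h \<in> carrier H"
  have xc: "of_blocks u \<in> configs G A" using of_blocks_periodic[OF u] by (simp add: periodic_configs_def)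
  let ?W = "restrict (shift H (inv\<^bsub>H\<^esub> h) u) (p ` M)"
  have W: "?W (p m) = u (h \<otimes>\<^bsub>H\<^esub> p m)" if "m \<in> M" for m
    using that h M_subset by (auto simp: shift_def)
  have "\<tau> (of_blocks u) (s h \<otimes> k) = \<mu> (\<lambda>m\<in>M. ?W (p m) (inv (s (p m)) \<otimes> (k \<otimes> m)))"
    if k: "k \<in> kernel G H p" for k
  proof -
    have "of_blocks u (s h \<otimes> k \<otimes> m) = ?W (p m) (inv (s (p m)) \<otimes> (k \<otimes> m))" if m: "m \<in> M" for m
    proof -
      have c: "m \<in> carrier G" "k \<in> carrier G" "p k = \<one>\<^bsub>H\<^esub>" using m M_subset k by (auto simp: mem_kernel)
      have "inv (s h) \<otimes> (s h \<otimes> (k \<otimes> m)) = k \<otimes> m" using c h by (simp flip: m_assoc)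
      then show ?thesis using c h W[OF m]
        by (simp add: of_blocks_def ps m_assoc inv_mult_group)
    qed
    then have "(\<lambda>m\<in>M. of_blocks u (s h \<otimes> k \<otimes> m)) = (\<lambda>m\<in>M. ?W (p m) (inv (s (p m)) \<otimes> (k \<otimes> m)))"
      by (rule restrict_ext)
    then show ?thesis using \<tau>_local[OF xc, of "s h \<otimes> k"] h k by (simp add: mem_kernel)
  qed
  then show "block_automaton u h = ?\<nu> ?W"
    using h by (auto simp: block_automaton_def to_blocks_def)
qed

text \<open>\<open>p\<close> is constant on orbits of \<open>L\<close>, so a difference confined to
  the orbits of \<open>F\<close> is seen only over the image of \<open>F\<close>.\<close>

lemma asymptotic_to_blocks:
  assumes F: "finite F" "F \<subseteq> carrier G"
    and eq: "\<And>g. g \<in> carrier G \<Longrightarrow> (\<And>l. l \<in> L \<Longrightarrow> l \<otimes> g \<notin> F) \<Longrightarrow> x g = y g"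
  shows "asymptotic H (to_blocks x) (to_blocks y)"
  unfolding asymptotic_iff
proof (intro exI[of _ "p ` F"] conjI ballI)
  fix h assume h: "h \<in> carrier H - p ` F"
  have "x (s h \<otimes> k) = y (s h \<otimes> k)" if k: "k \<in> kernel G H p" for k
  proof (rule eq)
    show "s h \<otimes> k \<in> carrier G" using h k by (simp add: mem_kernel)
    fix l assume l: "l \<in> L"
    have "p (l \<otimes> (s h \<otimes> k)) = h" using h k l L_mem by (simp add: mem_kernel ps)
    then show "l \<otimes> (s h \<otimes> k) \<notin> F" using h imageI by (metis DiffD2)
  qed
  then show "to_blocks x h = to_blocks y h" by (auto simp: to_blocks_def)
qed (use F in auto)

text \<open>The fibre of \<open>p\<close> over \<open>h\<close> consists of finitely many orbits of
  \<open>L\<close>, represented by the elements \<open>s h t\<close> with \<open>t\<close> in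
  \<open>T\<close>.\<close>

lemma asymptotic_of_blocks:
  assumes "asymptotic H u v"
  obtains F where "finite F" "F \<subseteq> carrier G"
    "\<And>g. g \<in> carrier G \<Longrightarrow> (\<And>l. l \<in> L \<Longrightarrow> l \<otimes> g \<notin> F) \<Longrightarrow> of_blocks u g = of_blocks v g"
proof -
  obtain E where E: "finite E" "E \<subseteq> carrier H" "\<And>h. h \<in> carrier H \<Longrightarrow> h \<notin> E \<Longrightarrow> u h = v h"
    using assms unfolding asymptotic_iff by blast
  let ?F = "(\<lambda>(h, t). s h \<otimes> t) ` (E \<times> T)"
  show ?thesis
  proof (rule that[of ?F])
    show "finite ?F" using E(1) T(1) by simp
    show "?F \<subseteq> carrier G" using E(2) T(2) by (auto simp: mem_kernel subset_iff)
    fix g assume g: "g \<in> carrier G" and off: "\<And>l. l \<in> L \<Longrightarrow> l \<otimes> g \<notin> ?F"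
    have "p g \<notin> E"
    proof
      assume pE: "p g \<in> E"
      obtain t l where t: "t \<in> T" "l \<in> L" "inv (s (p g)) \<otimes> g = l \<otimes> t"
        using T(3)[OF kernel_part[OF g]] by blast
      have c: "t \<in> carrier G" "l \<in> carrier G" using t T(2) L_mem by (auto simp: mem_kernel)
      have "g = s (p g) \<otimes> (l \<otimes> t)" using t(3) g c by (metis inv_solve_left m_closed p.hom_closed s.hom_closed)
      \<comment> \<open>The factor in front of \<open>g\<close> is a conjugate of
        \<open>l^-1\<close>, hence in \<open>L\<close>; it moves \<open>g\<close> to the
        representative \<open>s (p g) t\<close>.\<close>
      then have "s (p g) \<otimes> inv l \<otimes> inv (s (p g)) \<otimes> g = s (p g) \<otimes> inv l \<otimes> inv (s (p g)) \<otimes> (s (p g) \<otimes> (l \<otimes> t))"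
        by simp
      also have "\<dots> = s (p g) \<otimes> t"
      proof -
        have "inv (s (p g)) \<otimes> (s (p g) \<otimes> (l \<otimes> t)) = l \<otimes> t" "inv l \<otimes> (l \<otimes> t) = t"
          using g c by (simp_all flip: m_assoc)
        then show ?thesis using g c by (simp add: m_assoc)
      qed
      finally have "s (p g) \<otimes> inv l \<otimes> inv (s (p g)) \<otimes> g \<in> ?F" using pE t(1) by force
      moreover have "s (p g) \<otimes> inv l \<otimes> inv (s (p g)) \<in> L"
        using g t(2) normal.inv_op_closed2[OF L] subgroup.m_inv_closed[OF normal_imp_subgroup[OF L]] by simp
      ultimately show False using off by blast
    qed
    then show "of_blocks u g = of_blocks v g" using E(3) g by (simp add: of_blocks_def)
  qed
qed

text \<open>Under the translation, an asymptotic change over \<open>H\<close> becomes a change on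
  finitely many orbits of \<open>L\<close> in \<open>G\<close>, to which
  \<open>periodic_correct\<close> applies.\<close>

lemma block_automaton_post_surjective:
  assumes E: "finite E" "E \<subseteq> carrier G" "\<one> \<in> E"
    and unif: "corrects_within E"
    and disj: "L \<inter> (\<lambda>(d, m, m', d'). d \<otimes> inv m \<otimes> m' \<otimes> inv d') ` (E \<times> M \<times> M \<times> E) \<subseteq> {\<one>}"
  shows "post_surjective H blocks block_automaton"
  unfolding post_surjective_def
proof (intro ballI impI)
  fix u v assume u: "u \<in> configs H blocks" and v: "v \<in> configs H blocks"
    and as: "asymptotic H v (block_automaton u)"
  note x = of_blocks_periodic[OF u] and y = of_blocks_periodic[OF v]
  have \<tau>x: "\<tau> (of_blocks u) \<in> configs G A"
    using \<tau>_configs x by (simp add: periodic_configs_def)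
  obtain F where F: "finite F" "F \<subseteq> carrier G"
    "\<And>g. g \<in> carrier G \<Longrightarrow> (\<And>l. l \<in> L \<Longrightarrow> l \<otimes> g \<notin> F) \<Longrightarrow>
       of_blocks v g = of_blocks (block_automaton u) g"
    by (rule asymptotic_of_blocks[OF as]) blast
  have "\<exists>z\<in>periodic_configs G A L. \<exists>E'. finite E' \<and> E' \<subseteq> carrier G \<and>
    (\<forall>g\<in>carrier G. (\<forall>l\<in>L. l \<otimes> g \<notin> E') \<longrightarrow> z g = of_blocks u g) \<and> \<tau> z = of_blocks v"
  proof (rule periodic_correct[OF L E unif disj x F(1,2) y])
    fix g assume "g \<in> carrier G" "\<And>l. l \<in> L \<Longrightarrow> l \<otimes> g \<notin> F"
    from F(3)[OF this] show "of_blocks v g = \<tau> (of_blocks u) g"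
      by (simp add: block_automaton_def of_to_blocks \<tau>x)
  qed
  then obtain z E' where z: "z \<in> periodic_configs G A L" "finite E'" "E' \<subseteq> carrier G"
    "\<forall>g\<in>carrier G. (\<forall>l\<in>L. l \<otimes> g \<notin> E') \<longrightarrow> z g = of_blocks u g" "\<tau> z = of_blocks v"
    by (elim bexE exE conjE)
  have "asymptotic H (to_blocks z) u"
    using asymptotic_to_blocks[OF z(2,3), of z "of_blocks u"] z(4) to_of_blocks[OF u] by simp
  moreover have "block_automaton (to_blocks z) = v"
    using z(1,5) to_of_blocks[OF v] of_to_blocks by (simp add: block_automaton_def periodic_configs_def)
  ultimately show "\<exists>Z\<in>configs H blocks. asymptotic H Z u \<and> block_automaton Z = v"
    using to_blocks_configs[OF z(1)] by blast
qed

lemma periodic_pre_injective: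
  assumes inj: "pre_injective H blocks block_automaton"
    and xy: "x \<in> periodic_configs G A L" "y \<in> periodic_configs G A L" "\<tau> x = \<tau> y"
    and F: "finite F" "F \<subseteq> carrier G"
      "\<And>g. g \<in> carrier G \<Longrightarrow> (\<And>l. l \<in> L \<Longrightarrow> l \<otimes> g \<notin> F) \<Longrightarrow> x g = y g"
  shows "x = y"
proof -
  have c: "of_blocks (to_blocks x) = x" "of_blocks (to_blocks y) = y"
    using xy of_to_blocks by (auto simp: periodic_configs_def)
  have "asymptotic H (to_blocks x) (to_blocks y)"
    by (rule asymptotic_to_blocks[OF F(1,2)]) (rule F(3))
  moreover have "block_automaton (to_blocks x) = block_automaton (to_blocks y)"
    by (simp only: block_automaton_def c xy(3))
  ultimately have "to_blocks x = to_blocks y"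
    using inj to_blocks_configs[OF xy(1)] to_blocks_configs[OF xy(2)]
    unfolding pre_injective_def by blast
  then have "of_blocks (to_blocks x) = of_blocks (to_blocks y)" by (rule arg_cong)
  then show ?thesis by (simp only: c)
qed

text \<open>Both configurations are cut off outside \<open>D\<close> and the pieces are repeated
  along \<open>L\<close> over a constant background. The two periodic results have the same image,
  so they coincide, and on \<open>E\<close> they still show \<open>x\<close> and
  \<open>y\<close>.\<close>

lemma pre_injective_if_blocks:
  assumes inj: "pre_injective H blocks block_automaton"
    and x: "x \<in> configs G A" and y: "y \<in> configs G A" and eq: "\<tau> x = \<tau> y"
    and E: "finite E" "E \<subseteq> carrier G" "\<And>g. g \<in> carrier G \<Longrightarrow> g \<notin> E \<Longrightarrow> x g = y g"
    and D_def: "D = (\<lambda>(e, m, m'). e \<otimes> inv m \<otimes> m') ` (E \<times> M \<times> M)"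
    and disj: "L \<inter> (\<lambda>(d, m, m', d'). d \<otimes> inv m \<otimes> m' \<otimes> inv d') ` (D \<times> M \<times> M \<times> D) \<subseteq> {\<one>}"
  shows "x = y"
proof -
  have Ls: "subgroup L G" using L by (rule normal_imp_subgroup)
  have D: "finite D" "D \<subseteq> carrier G"
    using E(1,2) finite_M M_subset by (auto simp: D_def subset_iff)
  have ED: "E \<subseteq> D"
  proof
    fix e assume e: "e \<in> E"
    then have "e = e \<otimes> inv \<one> \<otimes> \<one>" using E(2) by auto
    then show "e \<in> D" using e one_M unfolding D_def by force
  qed
  have "(\<otimes>) \<one> ` D = D" using D(2) by force
  then have sep: "separated M L D" using separatedI[OF L D(2) M_subset one_closed disj] by simp
  \<comment> \<open>Any symbol of \<open>A\<close> would do as background; \<open>x \<one>\<close>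
    is one at hand.\<close>
  define c where "c = (\<lambda>g\<in>carrier G. x \<one>)"
  have "c \<in> configs G A"
    unfolding c_def by (rule restrict_in_configs) (use configs_in[OF x] in auto)
  then have c: "c \<in> periodic_configs G A L" using L_mem by (auto simp: periodic_configs_def c_def)
  define cut where "cut z = (\<lambda>g\<in>carrier G. if g \<in> D then z g else x \<one>)" for z
  have cutA: "cut z \<in> configs G A" if "z \<in> configs G A" for z
    unfolding cut_def by (rule restrict_in_configs) (use configs_in[OF x] configs_in[OF that] in auto)
  \<comment> \<open>A window meeting \<open>E\<close> lies inside \<open>D\<close>, where cutting
    changes nothing, and \<open>\<tau> x = \<tau> y\<close> applies. A window missing
    \<open>E\<close> shows the same symbols in both cut configurations.\<close>
  have \<tau>_cut: "\<tau> (cut x) g = \<tau> (cut y) g" if g: "g \<in> carrier G" for g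
  proof (cases "\<exists>m\<in>M. g \<otimes> m \<in> E")
    case True
    then obtain m where m: "m \<in> M" "g \<otimes> m \<in> E" by blast
    have "g \<otimes> m' \<in> D" if m': "m' \<in> M" for m'
    proof -
      have "g \<otimes> m' = (g \<otimes> m) \<otimes> inv m \<otimes> m'"
        using g m m' M_subset by (simp add: m_assoc subset_iff)
      then show ?thesis using m m' unfolding D_def by force
    qed
    then have "\<tau> (cut z) g = \<tau> z g" if "z \<in> configs G A" for z
      using D(2) by (intro \<tau>_cong cutA that g) (auto simp: cut_def)
    then show ?thesis using x y eq by simp
  next
    case False
    then show ?thesis
      using g M_subset E(3) by (intro \<tau>_cong cutA x y g) (auto simp: cut_def)
  qed
  note ctxt = Ls D(2) sep c
  let ?P = "\<lambda>z. periodize L D c (cut z)"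
  have off: "cut z g = c g" if "g \<in> carrier G" "g \<notin> D" for z g
    using that by (simp add: cut_def c_def)
  have per: "?P z \<in> periodic_configs G A L" if "z \<in> configs G A" for z
    by (rule periodize_periodic[OF ctxt cutA[OF that]])
  have "?P x = ?P y"
  proof (rule periodic_pre_injective[OF inj per[OF x] per[OF y] _ D])
    show "\<tau> (?P x) = \<tau> (?P y)"
    proof (rule configs_eqI)
      show "\<tau> (?P x) \<in> configs G A" "\<tau> (?P y) \<in> configs G A"
        using \<tau>_configs per x y by (auto simp: periodic_configs_def)
      fix g assume g: "g \<in> carrier G"
      obtain l where l: "l \<in> L" and loc: "\<And>w. w \<in> configs G A \<Longrightarrow>
          (\<And>h. h \<in> carrier G \<Longrightarrow> h \<notin> D \<Longrightarrow> w h = c h) \<Longrightarrow> \<tau> (periodize L D c w) g = \<tau> w (l \<otimes> g)"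
        by (rule periodize_local[OF ctxt g]) blast
      have "\<tau> (?P z) g = \<tau> (cut z) (l \<otimes> g)" if "z \<in> configs G A" for z
        using loc[OF cutA[OF that] off] by simp
      then show "\<tau> (?P x) g = \<tau> (?P y) g" using x y \<tau>_cut g l L_mem by simp
    qed
    show "?P x g = ?P y g" if "g \<in> carrier G" "\<And>l. l \<in> L \<Longrightarrow> l \<otimes> g \<notin> D" for g
      using periodize_off[OF ctxt that] by metis
  qed
  moreover have "?P z g = z g" if "g \<in> E" for z g
  proof -
    have g: "g \<in> carrier G" "g \<in> D" using that E(2) ED by auto
    then have "\<one> \<otimes> g \<in> D" by simp
    then show ?thesis
      using periodize_at[OF ctxt g(1) subgroup.one_closed[OF Ls]] g by (simp add: cut_def)
  qed
  ultimately have "x g = y g" if "g \<in> carrier G" for g using E(3) that by metis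
  then show ?thesis by (rule configs_eqI[OF x y])
qed

end

section \<open>Choice of the subgroup and conclusion\<close>

theorem theorem6p1:
  fixes K :: "('k, 'm1) monoid_scheme" and G :: "('g, 'm2) monoid_scheme"
    and H :: "('h, 'm3) monoid_scheme"
    and i :: "'k \<Rightarrow> 'g" and p :: "'g \<Rightarrow> 'h" and s :: "'h \<Rightarrow> 'g"
  assumes "group K" and "group G" and "group H"
    and "split_extension K G H i p s"
    and "post_injunctive H"
    and "finitely_generated K" and "residually_finite K"
  shows "post_injunctive G"
  unfolding post_injunctive_def
proof (intro allI impI)
  fix A :: "nat set" and \<tau>
  assume A: "finite A" and ca: "cellular_automaton G A \<tau>" and post: "post_surjective G A \<tau>"
  interpret G: group G by fact
  have i: "i \<in> mon K G" "i ` carrier K = kernel G H p" and p: "p \<in> hom G H"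
    and s: "s \<in> hom H G" "\<And>h. h \<in> carrier H \<Longrightarrow> p (s h) = h"
    using assms(4) by (auto simp: split_extension_def epi_def)
  interpret p: group_hom G H p
    using p assms(2,3) by (simp add: group_hom_def group_hom_axioms_def)
  interpret s: group_hom H G s
    using s assms(2,3) by (simp add: group_hom_def group_hom_axioms_def)
  have iK: "i ` carrier K \<lhd> G" unfolding i(2) by (rule p.normal_kernel)
  obtain M \<mu> where "memory_automaton G A \<tau> M \<mu>" using G.cellular_automaton_memory[OF ca] .
  then interpret memory_automaton G A \<tau> M \<mu> .
  obtain E where E: "finite E" "\<one>\<^bsub>G\<^esub> \<in> E" "E \<subseteq> carrier G" "corrects_within E"
    by (rule uniform_post_surjective[OF A post])
  show "pre_injective G A \<tau>"
    unfolding pre_injective_def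
  proof (intro ballI impI)
    fix x y assume x: "x \<in> configs G A" and y: "y \<in> configs G A"
      and as: "asymptotic G x y" and eq: "\<tau> x = \<tau> y"
    obtain E' where E': "finite E'" "E' \<subseteq> carrier G" "\<And>g. g \<in> carrier G \<Longrightarrow> g \<notin> E' \<Longrightarrow> x g = y g"
      using as unfolding asymptotic_iff by blast
    \<comment> \<open>\<open>D\<close> thickens the difference set \<open>E'\<close> to contain
      every window that meets it.\<close>
    define D where "D = (\<lambda>(e, m, m'). e \<otimes>\<^bsub>G\<^esub> inv\<^bsub>G\<^esub> m \<otimes>\<^bsub>G\<^esub> m') ` (E' \<times> M \<times> M)"
    \<comment> \<open>\<open>Q C\<close> lists the obstructions to separation for patches of shape
      \<open>C\<close>. \<open>L\<close> must avoid them for \<open>E\<close>, to correct, and for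
      \<open>D\<close>, to repeat \<open>x\<close> and \<open>y\<close>. It may depend on this pair,
      since pre-injectivity is checked pair by pair.\<close>
    define Q where "Q C = (\<lambda>(d, m, m', d'). d \<otimes>\<^bsub>G\<^esub> inv\<^bsub>G\<^esub> m \<otimes>\<^bsub>G\<^esub> m' \<otimes>\<^bsub>G\<^esub> inv\<^bsub>G\<^esub> d') ` (C \<times> M \<times> M \<times> C)" for C
    have finite_Q: "finite (Q E \<union> Q D)" using E(1) E'(1) finite_M by (simp add: Q_def D_def)
    obtain L T where L: "L \<lhd> G" "L \<subseteq> kernel G H p" "L \<inter> (Q E \<union> Q D) \<subseteq> {\<one>\<^bsub>G\<^esub>}"
      and T: "finite T" "T \<subseteq> kernel G H p" "\<And>k. k \<in> kernel G H p \<Longrightarrow> \<exists>t\<in>T. \<exists>l\<in>L. k = l \<otimes>\<^bsub>G\<^esub> t"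
      by (rule normal_finite_index_avoiding[OF assms(1,2,6,7) i(1) iK finite_Q, unfolded i(2)]) blast
    have dE: "L \<inter> Q E \<subseteq> {\<one>\<^bsub>G\<^esub>}" and dD: "L \<inter> Q D \<subseteq> {\<one>\<^bsub>G\<^esub>}" using L(3) by auto
    interpret split_automaton G A \<tau> M \<mu> H p s L T
      by (intro split_automaton.intro split_automaton_axioms.intro memory_automaton_axioms assms(3)
          p.group_hom_axioms s.group_hom_axioms s(2) L(1,2) T)
    have "post_surjective H blocks block_automaton"
      by (rule block_automaton_post_surjective[OF E(1,3,2,4) dE[unfolded Q_def]])
    \<comment> \<open>The symbols here are functions rather than numbers, so post-injunctivity of
      \<open>H\<close> is applied after relabelling the alphabet.\<close>
    then have "pre_injective H blocks block_automaton"
      using post_injunctive_alphabet[OF assms(3,5) finite_blocks[OF A] block_automaton_cellular] by blast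
    then show "x = y"
      by (rule pre_injective_if_blocks[OF _ x y eq E' D_def dD[unfolded Q_def]])
  qed
qed

end
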